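(* Fix $0<p<1$, let $y=1-p/2$ and $m=m(n)=\lfloor p\binom n2\rfloor$. Let $\vec G(n,m)$ be the random directed graph on $[n]$ obtained by choosing a graph uniformly at random among all simple graphs on $[n]$ with exactly $m$ edges and then orienting each edge independently in either direction with probability $1/2$. Let $a,s,b,t$ be four distinct fixed vertices, $A$ the event that there is no directed path from $s$ to $a$, and $B$ the event that there is no directed path from $t$ to $b$. Then, as $n\to\infty$, $$\mathbb{P}(A\cap B)\sim 2y^{2n-4}\exp\!\left(-4\frac{p(1-p)}{(2-p)^2}\right)+2y^{2n-3}\exp\!\left(-4\frac{p(1-p)}{(2-p)^2}\right).$$
   Context: For functions $f,g$ of $n$, $f\sim g$ means $f/g\to 1$ as $n\to\infty$. Probabilities are taken in the joint probability space of the random graph and the random orientations. *)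

theory Defs
  imports "HOL-Probability.Probability" "Graph_Theory.Pair_Digraph"
begin

text \<open>
  A simple graph on \<open>{1..n}\<close> is given by its edge set, a set of two-element subsets of \<open>{1..n}\<close>.
\<close>

definition simple_graphs :: "nat \<Rightarrow> nat \<Rightarrow> nat set set set" where
  "simple_graphs n m = {E. E \<subseteq> {e. e \<subseteq> {1..n} \<and> card e = 2} \<and> card E = m}"

text \<open>
  For \<open>u \<noteq> v\<close> the edge \<open>{u, v}\<close> has the two orientations \<open>(u, v)\<close> and \<open>(v, u)\<close>.
\<close>

definition orientations :: "nat set \<Rightarrow> (nat \<times> nat) set" where
  "orientations e = {(u, v). {u, v} = e}"

text \<open>
  The second argument of \<open>Pi_pmf\<close> is only the value of the random function outside of \<open>E\<close>, so it
  does not influence the arc set \<open>f ` E\<close>. As \<open>pmf_of_set\<close> requires a finite nonempty set,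
  \<open>random_digraph n m\<close> is meaningful only for \<open>m \<le> n choose 2\<close>.
\<close>

definition random_digraph :: "nat \<Rightarrow> nat \<Rightarrow> nat pair_pre_digraph pmf" where
  "random_digraph n m = do {
     E \<leftarrow> pmf_of_set (simple_graphs n m);
     f \<leftarrow> Pi_pmf E undefined (\<lambda>e. pmf_of_set (orientations e));
     return_pmf \<lparr> pverts = {1..n}, parcs = f ` E \<rparr>
   }"

definition no_dipath :: "nat \<Rightarrow> nat \<Rightarrow> nat pair_pre_digraph set" where
  "no_dipath u v = {G. \<nexists>P. pre_digraph.apath (with_proj G) u P v}"

lemma finite_simple_graphs: "finite (simple_graphs n m)"
  unfolding simple_graphs_def by (rule finite_subset[of _ "Pow (Pow {1..n})"]) (blast, simp)

lemma simple_graphs_nonempty: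
  assumes "m \<le> n choose 2"
  shows "simple_graphs n m \<noteq> {}"
proof -
  have "card {e. e \<subseteq> {1..n} \<and> card e = 2} = n choose 2"
    using n_subsets[of "{1..n}" 2] by simp
  with assms have "m \<le> card {e. e \<subseteq> {1..n} \<and> card e = 2}" by simp
  from obtain_subset_with_card_n[OF this]
  obtain E where "E \<subseteq> {e. e \<subseteq> {1..n} \<and> card e = 2}" "card E = m" .
  then have "E \<in> simple_graphs n m" unfolding simple_graphs_def by blast
  then show ?thesis by blast
qed

lemma orientations_doubleton: "orientations {u, v} = {(u, v), (v, u)}"
  unfolding orientations_def doubleton_eq_iff by blast

end

theory Submission
  imports Defs "HOL-Real_Asymp.Real_Asymp"
begin

text \<open>
  There is no path from \<open>s\<close> to \<open>a\<close> iff some vertex set containing \<open>s\<close> but not \<open>a\<close> is left by no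
  arc. Such a set \<open>S\<close> forbids \<open>|S| (n - |S|)\<close> arcs, and avoiding \<open>f\<close> given arcs has probability at most
  \<open>O(n\<^sup>2) y^f\<close>: conditioning \<open>G(n, p)\<close> on having \<open>m\<close> edges costs only the inverse of the largest
  binomial weight. Closed sets of size between \<open>3\<close> and \<open>n - 3\<close>, and pairs of a small and a co-small
  closed set of total (co)size at least \<open>3\<close>, each forbid at least \<open>3 n - O(1)\<close> arcs and are negligible
  against \<open>y^(2 n)\<close>. As closed sets are stable under union and intersection, what remains are the
  events that \<open>{s, t}\<close> is closed, that the complement of \<open>{a, b}\<close> is closed (\<open>2 n - 4\<close> forbidden arcs
  each), that \<open>{s}\<close> and the complement of \<open>{b}\<close> are closed, or that \<open>{t}\<close> and the complement of \<open>{a}\<close>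
  are closed (\<open>2 n - 3\<close> arcs each). Off the negligible events these four are disjoint.

  For \<open>k\<close> forbidden arcs on distinct vertex pairs the probability is \<open>E(2^(-X))\<close> with \<open>X\<close>
  hypergeometric. Relative to the binomial weights, the hypergeometric weight at \<open>j = u k\<close> is
  asymptotically \<open>G(u) = exp (- 4 (u - p)\<^sup>2 / (p (1 - p)))\<close> when \<open>k ~ 2 n\<close>, uniformly in \<open>j\<close>. The sum of
  the tilted binomial weights times \<open>G(j / k)\<close> is \<open>y^k\<close> times a Bernstein polynomial of \<open>G\<close> at
  \<open>q = p / (2 - p)\<close>, which tends to \<open>G(q)\<close>, the exponential factor of the theorem.
\<close>

section \<open>Hypergeometric weights\<close>


lemma fact_falling:
  assumes "j \<le> M"
  shows "(fact M :: real) = (\<Prod>i<j. real M - real i) * fact (M - j)"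
  using assms
proof (induction j)
  case (Suc j)
  then have "M - j = Suc (M - Suc j)" by simp
  then have "(fact (M - j) :: real) = (real M - real j) * fact (M - Suc j)"
    using Suc.prems by (simp only: fact_Suc of_nat_mult) (simp add: of_nat_diff)
  with Suc show ?case by simp
qed simp

text \<open>Split each of the factorials of \<open>m\<close>, \<open>N - m\<close> and
  \<open>N\<close> into a falling product and a remaining factorial: the remaining factorials
  cancel. The three surviving products have \<open>j\<close>, \<open>k - j\<close> and
  \<open>k\<close> factors, so each can be estimated separately.\<close>

lemma hypergeometric_weight:
  assumes "j \<le> k" "k \<le> m" "k \<le> N - m" "m \<le> N"
  shows "real ((N - k) choose (m - j)) / real (N choose m) =
    (\<Prod>i<j. real m - real i) * (\<Prod>i<k-j. real (N - m) - real i) / (\<Prod>i<k. real N - real i)"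
proof -
  have eq: "N - k - (m - j) = N - m - (k - j)" using assms by linarith
  have 1: "real ((N - k) choose (m - j)) = fact (N - k) / (fact (m - j) * fact (N - m - (k - j)))"
    by (subst binomial_fact, use assms in linarith) (simp only: eq)
  have 2: "real (N choose m) = fact N / (fact m * fact (N - m))"
    using assms by (subst binomial_fact) auto
  have f: "(fact m :: real) = (\<Prod>i<j. real m - real i) * fact (m - j)"
    "(fact (N - m) :: real) = (\<Prod>i<k-j. real (N - m) - real i) * fact (N - m - (k - j))"
    "(fact N :: real) = (\<Prod>i<k. real N - real i) * fact (N - k)"
    using assms by (intro fact_falling; linarith)+
  have nz: "(\<Prod>i<k. real N - real i) \<noteq> 0" using assms by (auto)
  show ?thesis unfolding 1 2 f using nz by (simp add: field_simps)
qed

text \<open>This is \<open>ln (1 - z) = - z + O(z^2)\<close> summed over the factors: the linear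
  terms add up to \<open>j^2 / (2 M)\<close> plus \<open>O(j / M)\<close>, the quadratic ones to
  \<open>O(j^3 / M^2)\<close>. The shift \<open>d\<close> makes room for the rounding error in
  \<open>m\<close>, and the bound on \<open>j\<close> keeps every \<open>z\<close> in the range
  \<open>|z| \<le> 1/2\<close> of the Taylor estimate.\<close>

lemma falling_product_ln:
  fixes M d :: real
  assumes d: "\<bar>d\<bar> \<le> 1" and M: "real j + 1 \<le> M / 2"
  shows "(\<Prod>i<j. 1 - (real i + d) / M) > 0"
    and "\<bar>ln (\<Prod>i<j. 1 - (real i + d) / M) + (real j)\<^sup>2 / (2 * M)\<bar>
      \<le> 2 * real j / M + 2 * real j ^ 3 / M\<^sup>2"
proof -
  define z where "z i = (real i + d) / M" for i
  have M0: "M > 0" using M by linarith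
  have z: "\<bar>z i\<bar> \<le> real j / M" if "i < j" for i
    using that d M0 by (simp add: z_def divide_right_mono)
  have "real j / M \<le> 1 / 2" using M M0 by (simp add: field_simps)
  then have z2: "\<bar>z i\<bar> \<le> 1 / 2" if "i < j" for i using z[OF that] by linarith
  have pos: "1 - z i > 0" if "i < j" for i using z2[OF that] by linarith
  show "(\<Prod>i<j. 1 - (real i + d) / M) > 0"
    using pos by (intro prod_pos) (auto simp: z_def)
  have ln: "ln (\<Prod>i<j. 1 - z i) = (\<Sum>i<j. ln (1 - z i))"
    using pos by (intro ln_prod) force+
  have e: "\<bar>ln (1 - z i) + z i\<bar> \<le> 2 * (real j / M)\<^sup>2" if "i < j" for i
  proof -
    have "\<bar>ln (1 + - z i) - - z i\<bar> \<le> 2 * (- z i)\<^sup>2"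
      using z2[OF that] by (intro abs_ln_one_plus_x_minus_x_bound) auto
    also have "(- z i)\<^sup>2 \<le> (real j / M)\<^sup>2"
      using z[OF that] M0 by (simp flip: abs_le_square_iff)
    finally show ?thesis by simp
  qed
  have sumi: "2 * (\<Sum>i<j. real i) = real j * (real j - 1)"
    by (induction j) (auto simp: algebra_simps)
  have sz: "(\<Sum>i<j. z i) = (\<Sum>i<j. real i) / M + real j * d / M"
    by (simp add: z_def add_divide_distrib sum.distrib sum_divide_distrib)
  have "(\<Sum>i<j. real i) / M = (real j)\<^sup>2 / (2 * M) - real j / (2 * M)"
    using sumi M0 by (simp add: field_simps power2_eq_square)
  with sz have sz': "(\<Sum>i<j. z i) - (real j)\<^sup>2 / (2 * M) = real j / M * (d - 1/2)"
    using M0 by (simp add: field_simps)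
  have "\<bar>(\<Sum>i<j. z i) - (real j)\<^sup>2 / (2 * M)\<bar> \<le> real j / M * 2"
    unfolding sz' abs_mult using d M0 by (intro mult_mono) auto
  moreover have "\<bar>(\<Sum>i<j. ln (1 - z i)) + (\<Sum>i<j. z i)\<bar> \<le> (\<Sum>i<j. 2 * (real j / M)\<^sup>2)"
    unfolding sum.distrib[symmetric] by (rule order_trans[OF sum_abs], rule sum_mono, rule e) simp
  moreover have "(\<Sum>i<j. 2 * (real j / M)\<^sup>2) = 2 * real j ^ 3 / M\<^sup>2"
    by (simp add: power2_eq_square power3_eq_cube field_simps)
  ultimately show "\<bar>ln (\<Prod>i<j. 1 - (real i + d) / M) + (real j)\<^sup>2 / (2 * M)\<bar>
      \<le> 2 * real j / M + 2 * real j ^ 3 / M\<^sup>2"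
    unfolding z_def[symmetric] ln by (simp add: abs_le_iff) 
qed

text \<open>Pulling \<open>p N\<close>, \<open>(1 - p) N\<close> and \<open>N\<close> out of the
  three falling products leaves the binomial weight times three products covered by
  \<open>falling_product_ln\<close>. With \<open>u = j / k\<close> their quadratic exponents combine
  through \<open>u^2 / p + (1 - u)^2 / (1 - p) - 1 = (u - p)^2 / (p (1 - p))\<close>. Each product
  contributes one error term, hence the factor 3.\<close>

lemma hypergeometric_weight_exp:
  fixes p r :: real
  assumes p: "0 < p" "p < 1" and r: "r = min p (1 - p)"
    and m: "m = nat \<lfloor>p * real N\<rfloor>"
    and k: "1 \<le> k" "real k + 1 \<le> r * real N / 2" and j: "j \<le> k"
  obtains err where "\<bar>err\<bar> \<le> 3 * (2 * real k / (r * real N) + 2 * real k ^ 3 / (r * real N)\<^sup>2)"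
    "real ((N - k) choose (m - j)) / real (N choose m) =
      p ^ j * (1 - p) ^ (k - j) *
      exp (- ((real k)\<^sup>2 / (2 * real N) * ((real j / real k - p)\<^sup>2 / (p * (1 - p)))) + err)"
proof -
  define l where "l = k - j"
  have lr: "real l = real k - real j" using j by (simp add: l_def)
  have r01: "0 < r" "r \<le> 1" "r \<le> p" "r \<le> 1 - p" using p r by auto
  have N0: "real N > 0" using k r01 by (cases "N = 0") auto
  have rp: "r * N \<le> p * N" "r * N \<le> (1 - p) * N" "r * N \<le> N"
    using r01 N0 by (auto intro: mult_right_mono)
  \<comment> \<open>The rounding error of \<open>m\<close>. It shifts the factors belonging to
    \<open>m\<close> by \<open>d\<close> and those belonging to \<open>N - m\<close> by
    \<open>- d\<close>.\<close>
  define d where "d = p * N - real m"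
  have fl: "real m = \<lfloor>p * real N\<rfloor>" unfolding m using p by simp
  have d: "0 \<le> d" "d \<le> 1" unfolding d_def fl by linarith+
  have mN: "real m \<le> p * N" using d d_def by linarith
  also have "\<dots> \<le> N" using p N0 by (simp add: mult_left_le_one_le)
  finally have mleN: "m \<le> N" by simp
  have mN': "real (N - m) = (1 - p) * N + d" using mleN by (simp add: d_def algebra_simps of_nat_diff)
  have km: "k \<le> m"
  proof -
    have "real k + 1 \<le> p * N" using k rp by linarith
    then show ?thesis using d d_def by linarith
  qed
  have kNm: "k \<le> N - m"
  proof -
    have "real k + 1 \<le> (1 - p) * N" using k rp by linarith
    then show ?thesis using d mN' by linarith
  qed
  define P1 where "P1 = (\<Prod>i<j. 1 - (real i + d) / (p * N))"
  define P2 where "P2 = (\<Prod>i<l. 1 - (real i + (- d)) / ((1 - p) * N))"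
  define P3 where "P3 = (\<Prod>i<k. 1 - (real i + 0) / N)"
  define bd where "bd = 2 * real k / (r * real N) + 2 * real k ^ 3 / (r * real N)\<^sup>2"
  \<comment> \<open>The error grows with the length and falls with \<open>M\<close>, so its value at
    length \<open>k\<close> and \<open>M = r N\<close> serves all three products.\<close>
  have bdle: "2 * real i / M + 2 * real i ^ 3 / M\<^sup>2 \<le> bd" if "i \<le> k" "r * N \<le> M" for i M
    unfolding bd_def using that r01 N0 by (intro add_mono frac_le mult_left_mono power_mono) auto
  have j1: "real j + 1 \<le> p * N / 2" using k rp j by linarith
  have l1: "real l + 1 \<le> (1 - p) * N / 2" using k rp lr by linarith
  have k1: "real k + 1 \<le> N / 2" using k rp by linarith
  define e1 where "e1 = ln P1 + (real j)\<^sup>2 / (2 * (p * N))"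
  define e2 where "e2 = ln P2 + (real l)\<^sup>2 / (2 * ((1 - p) * N))"
  define e3 where "e3 = ln P3 + (real k)\<^sup>2 / (2 * real N)"
  have P1: "P1 > 0" "\<bar>e1\<bar> \<le> bd"
    unfolding P1_def e1_def
    by (rule falling_product_ln; use d j1 in simp)
       (rule order_trans[OF falling_product_ln(2) bdle]; use d j1 j rp in simp)
  have P2: "P2 > 0" "\<bar>e2\<bar> \<le> bd"
    unfolding P2_def e2_def
    by (rule falling_product_ln; use d l1 in simp)
       (rule order_trans[OF falling_product_ln(2) bdle]; use d l1 rp l_def in simp)
  have P3: "P3 > 0" "\<bar>e3\<bar> \<le> bd"
    unfolding P3_def e3_def
    by (rule falling_product_ln; use k1 in simp)
       (rule order_trans[OF falling_product_ln(2) bdle]; use k1 rp in simp)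
  have q1: "(\<Prod>i<j. real m - real i) = (p * N) ^ j * P1"
  proof -
    have "real m - real i = (p * N) * (1 - (real i + d) / (p * N))" for i
      using p N0 by (simp add: d_def field_simps)
    then show ?thesis by (simp add: prod.distrib P1_def power_mult_distrib)
  qed
  have q2: "(\<Prod>i<l. real (N - m) - real i) = ((1 - p) * N) ^ l * P2"
  proof -
    have "real (N - m) - real i = ((1 - p) * N) * (1 - (real i + (- d)) / ((1 - p) * N))" for i
      using p N0 unfolding mN' by (simp add: field_simps)
    then show ?thesis by (simp add: prod.distrib P2_def power_mult_distrib)
  qed
  have q3: "(\<Prod>i<k. real N - real i) = real N ^ k * P3"
  proof -
    have "real N - real i = N * (1 - (real i + 0) / N)" for i
      using N0 by (simp add: field_simps)
    then show ?thesis by (simp add: prod.distrib P3_def power_mult_distrib)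
  qed
  have kjl: "k = j + l" using j l_def by simp
  have "real ((N - k) choose (m - j)) / real (N choose m)
      = (p * N) ^ j * P1 * (((1 - p) * N) ^ l * P2) / (real N ^ k * P3)"
    using hypergeometric_weight[OF j km kNm mleN] q1 q2 q3 by (simp add: l_def)
  also have "\<dots> = (real N ^ j * real N ^ l) / (real N ^ j * real N ^ l) * (p ^ j * (1 - p) ^ l * (P1 * P2 / P3))"
    unfolding kjl power_add power_mult_distrib by simp
  also have "(real N ^ j * real N ^ l) / (real N ^ j * real N ^ l) = 1" using N0 by simp
  also have "1 * (p ^ j * (1 - p) ^ l * (P1 * P2 / P3)) = p ^ j * (1 - p) ^ l * (P1 * P2 / P3)" by simp
  also have "P1 * P2 / P3 = exp (ln P1 + ln P2 - ln P3)"
    using P1(1) P2(1) P3(1) by (simp add: exp_add exp_diff)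
  also have "ln P1 + ln P2 - ln P3 = - ((real k)\<^sup>2 / (2 * real N) *
      ((real j / real k - p)\<^sup>2 / (p * (1 - p)))) + (e1 + e2 - e3)"
  proof -
    have *: "(real j)\<^sup>2 / (2 * (p * N)) + (real l)\<^sup>2 / (2 * ((1 - p) * N)) - (real k)\<^sup>2 / (2 * real N)
      = (real k)\<^sup>2 / (2 * real N) * ((real j / real k - p)\<^sup>2 / (p * (1 - p)))"
    proof -
      define u where "u = real j / real k"
      have ju: "real j = u * k" using k by (simp add: u_def)
      then have lu: "real l = (1 - u) * k" using lr by (simp add: algebra_simps)
      have "u\<^sup>2 / p + (1 - u)\<^sup>2 / (1 - p) - 1 = (u - p)\<^sup>2 / (p * (1 - p))"
        using p by (simp add: divide_simps) (simp add: power2_eq_square algebra_simps)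
      then have "(real k)\<^sup>2 / (2 * real N) * ((u - p)\<^sup>2 / (p * (1 - p)))
        = (real k)\<^sup>2 / (2 * real N) * (u\<^sup>2 / p + (1 - u)\<^sup>2 / (1 - p) - 1)" by simp
      also have "\<dots> = (real k)\<^sup>2 / (2 * real N) * (u\<^sup>2 / p)
          + (real k)\<^sup>2 / (2 * real N) * ((1 - u)\<^sup>2 / (1 - p)) - (real k)\<^sup>2 / (2 * real N)"
        by (simp only: distrib_left right_diff_distrib mult_1_right)
      also have "\<dots> = (u * k)\<^sup>2 / (2 * (p * N)) + ((1 - u) * k)\<^sup>2 / (2 * ((1 - p) * N)) - (real k)\<^sup>2 / (2 * real N)"
        by (simp add: power_mult_distrib mult_ac)
      finally show ?thesis unfolding ju[symmetric] lu[symmetric] u_def[symmetric] by simp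
    qed
    show ?thesis unfolding e1_def e2_def e3_def using * by (simp add: algebra_simps)
  qed
  finally have "real ((N - k) choose (m - j)) / real (N choose m) = p ^ j * (1 - p) ^ (k - j) *
      exp (- ((real k)\<^sup>2 / (2 * real N) * ((real j / real k - p)\<^sup>2 / (p * (1 - p)))) + (e1 + e2 - e3))"
    by (simp only: l_def)
  moreover have "\<bar>e1 + e2 - e3\<bar> \<le> 3 * bd" using P1 P2 P3 by linarith
  ultimately show ?thesis using that unfolding bd_def by blast
qed

text \<open>
  The expectation of \<open>2^(-X)\<close>, where \<open>X\<close> counts the marked elements, \<open>k\<close> out of \<open>N\<close>, in a random
  \<open>m\<close>-subset. Truncated subtraction makes the formula wrong for \<open>j > m\<close>, so it is used for \<open>k \<le> m\<close>.
\<close>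

definition hypergeometric_half :: "nat \<Rightarrow> nat \<Rightarrow> nat \<Rightarrow> real" where
  "hypergeometric_half N m k =
    (\<Sum>j\<le>k. real (k choose j) * real ((N - k) choose (m - j)) * (1/2) ^ j) / real (N choose m)"

text \<open>The quotient is squeezed between \<open>exp (- E n) * S n\<close> and
  \<open>exp (E n) * S n\<close>. Here \<open>S n\<close> is the Bernstein polynomial of
  \<open>G\<close> at \<open>q\<close>, which tends to \<open>G q\<close> by uniform approximation,
  and \<open>E n\<close> tends to 0 and bounds the error in the exponent for all \<open>j\<close> at
  once.\<close>

lemma hypergeometric_half_asymp:
  fixes p y :: real and N m k :: "nat \<Rightarrow> nat"
  assumes p: "0 < p" "p < 1" and y: "y = 1 - p / 2"
    and m: "\<And>n. m n = nat \<lfloor>p * real (N n)\<rfloor>"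
    and N: "filterlim (\<lambda>n. real (N n)) at_top sequentially"
    and k: "filterlim k at_top sequentially"
    and kN: "(\<lambda>n. (real (k n))\<^sup>2 / (2 * real (N n))) \<longlonglongrightarrow> c"
  shows "(\<lambda>n. hypergeometric_half (N n) (m n) (k n) / y ^ k n)
    \<longlonglongrightarrow> exp (- (c * (p * (1 - p) / (2 - p)\<^sup>2)))"
proof -
  define r where "r = min p (1 - p)"
  have r0: "r > 0" using p by (simp add: r_def)
  have y0: "y > 0" using y p by simp
  \<comment> \<open>A forbidden arc is avoided because its edge is present with the other
    orientation, weight \<open>p / 2\<close>, or because the edge is absent, weight
    \<open>1 - p\<close>. The two weights add up to \<open>y\<close>; dividing by \<open>y\<close>
    yields the probabilities \<open>q\<close> and \<open>1 - q\<close>.\<close>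
  define q where "q = (p / 2) / y"
  have "1 - q = (y - p / 2) / y" using y0 by (simp add: q_def diff_divide_distrib)
  then have q1: "1 - q = (1 - p) / y" by (simp add: y)
  have q01: "q \<in> {0..1}" using p y y0 by (auto simp: q_def field_simps)
  define G where "G u = exp (- (c * ((u - p)\<^sup>2 / (p * (1 - p)))))" for u :: real
  have "q = p / (2 - p)" by (simp add: q_def y divide_simps)
  then have "p - q = p * (1 - p) / (2 - p)" using p by (simp add: field_simps)
  then have "(q - p)\<^sup>2 = (p * (1 - p) / (2 - p))\<^sup>2" by (metis power2_commute)
  then have Gq: "G q = exp (- (c * (p * (1 - p) / (2 - p)\<^sup>2)))"
    using p by (simp add: G_def power_divide power_mult_distrib power2_eq_square)
  \<comment> \<open>The first summand is the error of \<open>hypergeometric_weight_exp\<close>. The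
    second one pays for replacing \<open>k^2 / (2 N)\<close> by its limit \<open>c\<close>, using
    \<open>(j / k - p)^2 \<le> 1\<close>.\<close>
  define E where "E n = 3 * (2 * real (k n) / (r * real (N n)) + 2 * real (k n) ^ 3 / (r * real (N n))\<^sup>2)
     + \<bar>c - (real (k n))\<^sup>2 / (2 * real (N n))\<bar> / (p * (1 - p))" for n
  define S where "S n = (\<Sum>j\<le>k n. G (real j / real (k n)) * Bernstein (k n) j q)" for n
  have k': "filterlim (\<lambda>n. real (k n)) at_top sequentially"
    using filterlim_compose[OF filterlim_real_sequentially k] by simp
  have kN0: "(\<lambda>n. real (k n) / real (N n)) \<longlonglongrightarrow> 0"
  proof -
    have lim: "(\<lambda>n. 2 * ((real (k n))\<^sup>2 / (2 * real (N n))) * inverse (real (k n))) \<longlonglongrightarrow> 2 * c * 0"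
      by (intro tendsto_intros kN tendsto_inverse_0_at_top k')
    have eq: "2 * ((real (k n))\<^sup>2 / (2 * real (N n))) * inverse (real (k n)) = real (k n) / real (N n)" for n
      by (cases "k n = 0") (auto simp: field_simps power2_eq_square)
    show ?thesis using lim unfolding eq by simp
  qed
  have "E \<longlonglongrightarrow> 3 * (2 / r * 0 + 4 / r\<^sup>2 * c * 0) + \<bar>c - c\<bar> / (p * (1 - p))"
  proof -
    have eq: "E n = 3 * (2 / r * (real (k n) / real (N n)) + 4 / r\<^sup>2 * ((real (k n))\<^sup>2 / (2 * real (N n))) * (real (k n) / real (N n)))
       + \<bar>c - (real (k n))\<^sup>2 / (2 * real (N n))\<bar> / (p * (1 - p))" for n
      by (simp add: E_def power2_eq_square power3_eq_cube mult_ac)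
    show ?thesis unfolding eq using p by (intro tendsto_intros kN kN0) auto
  qed
  then have E: "E \<longlonglongrightarrow> 0" by simp
  have S: "S \<longlonglongrightarrow> G q"
  proof (rule LIMSEQ_I)
    fix e :: real assume e: "0 < e"
    have "continuous_on {0..1} G" unfolding G_def using p by (intro continuous_intros) auto
    from Bernstein_Weierstrass[OF this e] obtain N0 where
      N0: "\<And>n x. N0 \<le> n \<Longrightarrow> x \<in> {0..1} \<Longrightarrow> \<bar>G x - (\<Sum>j\<le>n. G (j/n) * Bernstein n j x)\<bar> < e"
      by blast
    have "\<forall>\<^sub>F n in sequentially. N0 \<le> k n" using k by (simp add: filterlim_at_top)
    then obtain n0 where n0: "\<And>n. n \<ge> n0 \<Longrightarrow> N0 \<le> k n" unfolding eventually_sequentially by blast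
    show "\<exists>no. \<forall>n\<ge>no. norm (S n - G q) < e"
    proof (intro exI[of _ n0] allI impI)
      fix n assume "n \<ge> n0"
      from N0[OF n0[OF this] q01] show "norm (S n - G q) < e"
        by (simp add: S_def abs_minus_commute)
    qed
  qed
  have G0: "G u \<ge> 0" for u by (simp add: G_def)
  have "\<forall>\<^sub>F n in sequentially. (real (k n) / real (N n)) < r / 4"
    using kN0 r0 by (intro order_tendstoD(2)[OF kN0]) simp
  moreover have "\<forall>\<^sub>F n in sequentially. 1 \<le> k n" using k by (simp add: filterlim_at_top)
  moreover have "\<forall>\<^sub>F n in sequentially. real (N n) \<ge> 1" using N unfolding filterlim_at_top by blast
  ultimately have ev: "\<forall>\<^sub>F n in sequentially.
    exp (- E n) * S n \<le> hypergeometric_half (N n) (m n) (k n) / y ^ k n \<and>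
    hypergeometric_half (N n) (m n) (k n) / y ^ k n \<le> exp (E n) * S n"
  proof eventually_elim
    case (elim n)
    let ?k = "k n" and ?N = "N n" and ?m = "m n"
    \<comment> \<open>From \<open>1 \<le> k\<close> and \<open>k / N < r / 4\<close> one gets
      \<open>k + 1 \<le> 2 k \<le> r N / 2\<close>.\<close>
    have k2: "real ?k + 1 \<le> r * real ?N / 2" using elim by (simp add: field_simps)
    have bounds: "exp (- E n) * (G (real j / real ?k) * Bernstein ?k j q) \<le> t \<and>
        t \<le> exp (E n) * (G (real j / real ?k) * Bernstein ?k j q)"
      if j: "j \<le> ?k" and t: "t = real (?k choose j) * (real ((?N - ?k) choose (?m - j)) / real (?N choose ?m)) * (1/2) ^ j / y ^ ?k"
      for j t
    proof -
      obtain err where err: "\<bar>err\<bar> \<le> 3 * (2 * real ?k / (r * real ?N) + 2 * real ?k ^ 3 / (r * real ?N)\<^sup>2)"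
        "real ((?N - ?k) choose (?m - j)) / real (?N choose ?m) =
        p ^ j * (1 - p) ^ (?k - j) *
        exp (- ((real ?k)\<^sup>2 / (2 * real ?N) * ((real j / real ?k - p)\<^sup>2 / (p * (1 - p)))) + err)"
        using hypergeometric_weight_exp[OF p r_def m[of n] elim(2) k2 j] by metis
      define v where "v = (real j / real ?k - p)\<^sup>2 / (p * (1 - p))"
      define e where "e = err + (c - (real ?k)\<^sup>2 / (2 * real ?N)) * v"
      have "0 \<le> real j / real ?k" "real j / real ?k \<le> 1" using j elim by (auto simp: field_simps)
      then have "\<bar>real j / real ?k - p\<bar> \<le> 1" using p by linarith
      then have "(real j / real ?k - p)\<^sup>2 \<le> 1" by (simp add: abs_square_le_1)
      then have v: "0 \<le> v" "v \<le> 1 / (p * (1 - p))" unfolding v_def using p by (auto intro: divide_right_mono)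
      have "\<bar>(c - (real ?k)\<^sup>2 / (2 * real ?N)) * v\<bar> \<le> \<bar>c - (real ?k)\<^sup>2 / (2 * real ?N)\<bar> * (1 / (p * (1 - p)))"
        unfolding abs_mult using v by (intro mult_left_mono) auto
      then have e: "\<bar>e\<bar> \<le> E n" unfolding e_def E_def using err(1) by simp
      have "y ^ ?k = y ^ j * y ^ (?k - j)" using j by (simp flip: power_add)
      then have B: "Bernstein ?k j q = real (?k choose j) * p ^ j * (1 - p) ^ (?k - j) * (1/2) ^ j / y ^ ?k"
        by (simp add: Bernstein_def q1) (simp add: q_def power_divide)
      have "t = Bernstein ?k j q * exp (- ((real ?k)\<^sup>2 / (2 * real ?N) * v) + err)"
        unfolding t err(2) B v_def by simp
      also have "- ((real ?k)\<^sup>2 / (2 * real ?N) * v) + err = - (c * v) + e"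
        by (simp add: e_def algebra_simps)
      also have "Bernstein ?k j q * exp (- (c * v) + e) = exp e * (G (real j / real ?k) * Bernstein ?k j q)"
        by (simp only: exp_add G_def v_def) simp
      finally have t: "t = exp e * (G (real j / real ?k) * Bernstein ?k j q)" .
      have "0 \<le> G (real j / real ?k) * Bernstein ?k j q"
        using G0 q01 Bernstein_nonneg by simp
      then show ?thesis unfolding t using e by (auto intro!: mult_right_mono)
    qed
    have sum: "hypergeometric_half ?N ?m ?k / y ^ ?k =
        (\<Sum>j\<le>?k. real (?k choose j) * (real ((?N - ?k) choose (?m - j)) / real (?N choose ?m)) * (1/2) ^ j / y ^ ?k)"
      unfolding hypergeometric_half_def sum_divide_distrib by (intro sum.cong) auto
    show ?case unfolding sum S_def sum_distrib_left
      using bounds by (auto intro!: sum_mono)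
  qed
  have lim1: "(\<lambda>n. exp (- E n) * S n) \<longlonglongrightarrow> exp (- 0) * G q"
    by (intro tendsto_intros E S)
  have lim2: "(\<lambda>n. exp (E n) * S n) \<longlonglongrightarrow> exp 0 * G q"
    by (intro tendsto_intros E S)
  have "(\<lambda>n. hypergeometric_half (N n) (m n) (k n) / y ^ k n) \<longlonglongrightarrow> G q"
    by (rule tendsto_sandwich[where f = "\<lambda>n. exp (- E n) * S n" and h = "\<lambda>n. exp (E n) * S n"])
       (use ev lim1 lim2 in \<open>auto elim: eventually_mono\<close>)
  then show ?thesis by (simp add: Gq)
qed

section \<open>Avoiding a set of arcs\<close>

text \<open>Up to the factor \<open>(1 - p) ^ N\<close> the terms are binomial weights, with
  consecutive ratio \<open>(N - i) p / ((i + 1) (1 - p))\<close>. They increase up to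
  \<open>m\<close> and decrease from \<open>m + 1\<close> on. As \<open>m\<close> rounds
  \<open>p N\<close> down, the maximum may sit at \<open>m + 1\<close>; the factor 2 covers that one
  step.\<close>

lemma binomial_term_le_mode:
  fixes p :: real
  assumes p: "0 < p" "p < 1" and m: "m = nat \<lfloor>p * real N\<rfloor>" and N: "1 \<le> real N * (1 - p)"
    and k: "k \<le> N"
  shows "real (N choose k) * (p / (1 - p)) ^ k \<le> 2 * (real (N choose m) * (p / (1 - p)) ^ m)"
proof -
  define t where "t k = real (N choose k) * (p / (1 - p)) ^ k" for k
  have t0: "t k \<ge> 0" for k using p by (simp add: t_def)
  have fl: "real m = \<lfloor>p * real N\<rfloor>" unfolding m using p by simp
  have m1: "real m \<le> p * N" "p * N < real m + 1" unfolding fl by linarith+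
  have "real m \<le> 1 * N" using m1 p mult_right_mono[of p 1 "real N"] by simp
  then have mN: "m \<le> N" by simp
  have rec: "t (Suc i) * (real (Suc i) * (1 - p)) = t i * (real (N - i) * p)" for i
  proof -
    have "Suc i * (N choose Suc i) = (N - i) * (N choose i)"
      by (simp only: binomial_absorb_comp binomial_absorption)
    then have *: "real (Suc i) * real (N choose Suc i) = real (N - i) * real (N choose i)"
      by (simp only: flip: of_nat_mult)
    have "t (Suc i) * (real (Suc i) * (1 - p))
        = (real (Suc i) * real (N choose Suc i)) * (p / (1 - p)) ^ i * (p / (1 - p) * (1 - p))"
      by (simp only: t_def power_Suc mult_ac)
    also have "p / (1 - p) * (1 - p) = p" using p by simp
    finally show ?thesis unfolding * by (simp only: t_def mult_ac)
  qed
  have up: "t i \<le> t (Suc i)" if "i < m" for i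
  proof -
    have "real (Suc i) * (1 - p) \<le> real m * (1 - p)" using that p by (intro mult_right_mono) auto
    also have "\<dots> \<le> p * N * (1 - p)" using m1 p by (intro mult_right_mono) auto
    also have "\<dots> \<le> real (N - i) * p"
    proof -
      have "real i \<le> p * N" using that m1 by linarith
      then have "(1 - p) * N \<le> real (N - i)" using that mN by (simp add: of_nat_diff algebra_simps)
      from mult_left_mono[OF this, of p] show ?thesis using p by (simp add: mult_ac)
    qed
    finally have "t i * (real (Suc i) * (1 - p)) \<le> t (Suc i) * (real (Suc i) * (1 - p))"
      unfolding rec using t0 by (intro mult_left_mono) auto
    then show ?thesis using p by simp
  qed
  have down: "t (Suc i) \<le> t i" if "m < i" for i
  proof -
    have *: "real (N - i) * p \<le> real (Suc i) * (1 - p)"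
    proof (cases "i \<le> N")
      case True
      have i: "p * N \<le> real i" using that m1 by linarith
      then have "real (N - i) * p \<le> (N - p * N) * p" using True p by (intro mult_right_mono) (auto simp: of_nat_diff)
      also have "\<dots> = p * N * (1 - p)" by (simp add: algebra_simps)
      also have "\<dots> \<le> real (Suc i) * (1 - p)" using i p by (intro mult_right_mono) auto
      finally show ?thesis .
    qed (use p in auto)
    have "t (Suc i) * (real (Suc i) * (1 - p)) \<le> t i * (real (Suc i) * (1 - p))"
      unfolding rec using * t0 by (intro mult_left_mono) auto
    then show ?thesis using p by simp
  qed
  have peak: "t (Suc m) \<le> 2 * t m"
  proof -
    \<comment> \<open>Rounding gives \<open>N - m \<le> N (1 - p) + 1\<close>, and the 1 is absorbed
      by the assumption \<open>1 \<le> N (1 - p)\<close>.\<close>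
    have "real (N - m) \<le> 2 * (N * (1 - p))" using mN m1 N by (simp add: of_nat_diff algebra_simps)
    then have "real (N - m) * p \<le> 2 * (N * (1 - p)) * p" using p by (intro mult_right_mono) auto
    also have "\<dots> = 2 * (p * N) * (1 - p)" by simp
    also have "\<dots> \<le> 2 * real (Suc m) * (1 - p)" using m1 p by (intro mult_right_mono) auto
    finally have "t (Suc m) * (real (Suc m) * (1 - p)) \<le> t m * (2 * real (Suc m) * (1 - p))"
      unfolding rec using t0 by (intro mult_left_mono) auto
    also have "\<dots> = (2 * t m) * (real (Suc m) * (1 - p))" by simp
    finally show ?thesis using p by (simp del: of_nat_Suc)
  qed
  have "t k \<le> 2 * t m"
  proof (cases "k \<le> m")
    case True
    then have "t k \<le> t m"
    proof (induction rule: inc_induct)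
      case (step i)
      then show ?case using up[of i] by linarith
    qed simp
    then show ?thesis using t0[of m] by linarith
  next
    case False
    then have "Suc m \<le> k" by simp
    then have "t k \<le> t (Suc m)"
    proof (induction rule: dec_induct)
      case (step i)
      then show ?case using down[of i] by linarith
    qed simp
    then show ?thesis using peak by linarith
  qed
  then show ?thesis by (simp add: t_def)
qed

text \<open>In probabilistic terms, a binomial variable with parameters \<open>N\<close> and
  \<open>p\<close> equals \<open>m\<close> with probability at least \<open>1 / (2 (N + 1))\<close>:
  none of its \<open>N + 1\<close> weights exceeds twice the one at \<open>m\<close>.\<close>

lemma power_le_binomial_mode:
  fixes p :: real
  assumes p: "0 < p" "p < 1" and m: "m = nat \<lfloor>p * real N\<rfloor>" and N: "1 \<le> real N * (1 - p)"
  shows "(1 + p / (1 - p)) ^ N \<le> 2 * (real N + 1) * (real (N choose m) * (p / (1 - p)) ^ m)"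
proof -
  have "(1 + p / (1 - p)) ^ N = (\<Sum>k\<le>N. real (N choose k) * (p / (1 - p)) ^ k)"
    using binomial_ring[of "p / (1 - p)" 1 N] by (simp add: add.commute)
  also have "\<dots> \<le> (\<Sum>k\<le>N. 2 * (real (N choose m) * (p / (1 - p)) ^ m))"
    using binomial_term_le_mode[OF p m N] by (intro sum_mono) simp
  finally show ?thesis by (simp add: algebra_simps)
qed

section \<open>Probability of avoiding a set of arcs: exact formula and bounds\<close>

definition vertex_pairs :: "nat \<Rightarrow> nat set set" where
  "vertex_pairs n = {e. e \<subseteq> {1..n} \<and> card e = 2}"

definition complete_arcs :: "nat \<Rightarrow> (nat \<times> nat) set" where
  "complete_arcs n = {(u, v). u \<in> {1..n} \<and> v \<in> {1..n} \<and> u \<noteq> v}"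

definition avoiding :: "(nat \<times> nat) set \<Rightarrow> nat pair_pre_digraph set" where
  "avoiding F = {G. parcs G \<inter> F = {}}"

text \<open>For a pair \<open>e\<close> of distinct vertices this is the probability that a
  uniformly random orientation of \<open>e\<close> lies outside \<open>F\<close>, so 1, 1/2 or
  0.\<close>

definition edge_weight :: "(nat \<times> nat) set \<Rightarrow> nat set \<Rightarrow> real" where
  "edge_weight F e = 1 - real (card (orientations e \<inter> F)) / 2"

lemma vertex_pairsE:
  assumes "e \<in> vertex_pairs n"
  obtains u v where "e = {u, v}" "u \<noteq> v" "u \<in> {1..n}" "v \<in> {1..n}"
  using assms unfolding vertex_pairs_def card_2_iff by auto

lemma finite_vertex_pairs [simp]: "finite (vertex_pairs n)"
  unfolding vertex_pairs_def by (rule finite_subset[of _ "Pow {1..n}"]) auto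

lemma card_vertex_pairs: "card (vertex_pairs n) = n choose 2"
  unfolding vertex_pairs_def using n_subsets[of "{1..n}" 2] by simp

lemma simple_graphs_conv: "simple_graphs n m = {E. E \<subseteq> vertex_pairs n \<and> card E = m}"
  by (simp add: simple_graphs_def vertex_pairs_def)

lemma card_simple_graphs: "card (simple_graphs n m) = (n choose 2) choose m"
  unfolding simple_graphs_conv using n_subsets[OF finite_vertex_pairs, of n m] card_vertex_pairs by simp

lemma card_orientations:
  assumes "e \<in> vertex_pairs n"
  shows "card (orientations e) = 2" "finite (orientations e)"
  using assms by (auto elim!: vertex_pairsE simp: orientations_doubleton card_insert_if)

lemma complete_arcs_conv: "complete_arcs n = (\<Union>e\<in>vertex_pairs n. orientations e)"
proof (rule set_eqI, clarify)
  fix u v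
  have "(u, v) \<in> complete_arcs n \<longleftrightarrow> {u, v} \<in> vertex_pairs n"
    by (auto simp: complete_arcs_def vertex_pairs_def card_insert_if)
  also have "\<dots> \<longleftrightarrow> (u, v) \<in> (\<Union>e\<in>vertex_pairs n. orientations e)"
    by (auto simp: orientations_def)
  finally show "(u, v) \<in> complete_arcs n \<longleftrightarrow> (u, v) \<in> (\<Union>e\<in>vertex_pairs n. orientations e)" .
qed

lemma card_arcs_conv_sum:
  assumes "F \<subseteq> complete_arcs n"
  shows "card F = (\<Sum>e\<in>vertex_pairs n. card (orientations e \<inter> F))"
proof -
  have "F = (\<Union>e\<in>vertex_pairs n. orientations e \<inter> F)"
    using assms unfolding complete_arcs_conv by blast
  also have "card \<dots> = (\<Sum>e\<in>vertex_pairs n. card (orientations e \<inter> F))"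
    by (intro card_UN_disjoint ballI impI) (simp_all add: card_orientations, auto simp: orientations_def)
  finally show ?thesis .
qed

lemma measure_bind_pmf:
  "measure_pmf.prob (bind_pmf p f) A = measure_pmf.expectation p (\<lambda>x. measure_pmf.prob (f x) A)"
  unfolding measure_pmf_bind
  by (subst measure_pmf.measure_bind[where N = "count_space UNIV"]) (auto simp: measure_pmf_in_subprob_algebra)

text \<open>Given the edge set, the orientations are independent and the event is a product set, so
  its probability factorises over the edges. It remains to average over the edge sets.\<close>

lemma prob_avoiding:
  assumes "m \<le> n choose 2"
  shows "measure_pmf.prob (random_digraph n m) (avoiding F) =
    (\<Sum>E\<in>simple_graphs n m. \<Prod>e\<in>E. edge_weight F e) / real ((n choose 2) choose m)"
proof -
  have inner: "measure_pmf.prob (Pi_pmf E undefined (\<lambda>e. pmf_of_set (orientations e)) \<bind>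
      (\<lambda>f. return_pmf \<lparr> pverts = {1..n}, parcs = f ` E \<rparr>)) (avoiding F) = (\<Prod>e\<in>E. edge_weight F e)"
    if E: "E \<in> simple_graphs n m" for E
  proof -
    have EV: "E \<subseteq> vertex_pairs n" using E by (simp add: simple_graphs_conv)
    then have fin: "finite E" by (rule finite_subset) simp
    have w: "measure_pmf.prob (pmf_of_set (orientations e)) (- F) = edge_weight F e" if "e \<in> E" for e
    proof -
      have e: "e \<in> vertex_pairs n" using EV that by blast
      have ne: "orientations e \<noteq> {}" using card_orientations(1)[OF e] by auto
      have "card (orientations e \<inter> F) + card (orientations e \<inter> - F) = 2"
        using card_orientations[OF e] by (subst card_Un_disjoint[symmetric]) (auto simp flip: Int_Un_distrib)
      then have "real (card (orientations e \<inter> - F)) = 2 - real (card (orientations e \<inter> F))" by linarith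
      then show ?thesis
        by (simp add: measure_pmf_of_set[OF ne card_orientations(2)[OF e]] card_orientations[OF e] edge_weight_def field_simps)
    qed
    have "(\<lambda>f. \<lparr> pverts = {1..n}, parcs = f ` E \<rparr>) -` avoiding F = Pi E (\<lambda>_. - F)"
      by (auto simp: avoiding_def Pi_def)
    then have "measure_pmf.prob (Pi_pmf E undefined (\<lambda>e. pmf_of_set (orientations e)) \<bind>
      (\<lambda>f. return_pmf \<lparr> pverts = {1..n}, parcs = f ` E \<rparr>)) (avoiding F)
      = measure_pmf.prob (Pi_pmf E undefined (\<lambda>e. pmf_of_set (orientations e))) (Pi E (\<lambda>_. - F))"
      by (simp add: map_pmf_def[symmetric])
    also have "\<dots> = (\<Prod>e\<in>E. edge_weight F e)"
      using w by (simp add: measure_Pi_pmf_Pi[OF fin])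
    finally show ?thesis .
  qed
  show ?thesis unfolding random_digraph_def
    using inner
    by (subst measure_bind_pmf, subst integral_pmf_of_set[OF simple_graphs_nonempty[OF assms] finite_simple_graphs])
       (simp add: card_simple_graphs)
qed

lemma edge_count_le:
  assumes "0 < p" "p < (1::real)"
  shows "nat \<lfloor>p * real N\<rfloor> \<le> N"
proof -
  have "p * real N \<le> real N" using assms by (simp add: mult_left_le_one_le)
  then have "\<lfloor>p * real N\<rfloor> \<le> int N" by (metis floor_mono floor_of_nat)
  then show ?thesis by simp
qed

lemma edge_weight_bounds:
  assumes "e \<in> vertex_pairs n"
  shows "card (orientations e \<inter> F) \<le> 2" "0 \<le> edge_weight F e"
proof -
  show "card (orientations e \<inter> F) \<le> 2"
    using card_mono[of "orientations e" "orientations e \<inter> F"] card_orientations[OF assms] by auto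
  then show "0 \<le> edge_weight F e" by (simp add: edge_weight_def)
qed

text \<open>With the odds \<open>x = p / (1 - p)\<close>, the sum over graphs with \<open>m\<close>
  edges, times \<open>x ^ m\<close>, is at most the sum over all graphs, which factorises over the
  vertex pairs. A pair with \<open>f\<close> forbidden orientations contributes
  \<open>1 - p + p * edge_weight F e\<close>, up to \<open>1 - p\<close>, and this is at most
  \<open>(1 - p / 2) ^ f\<close>, with equality for \<open>f = 0\<close> and \<open>f = 1\<close>.
  Finally \<open>power_le_binomial_mode\<close> removes the normalisation.\<close>

lemma prob_avoiding_le:
  fixes p :: real
  assumes p: "0 < p" "p < 1" and m: "m = nat \<lfloor>p * real (n choose 2)\<rfloor>"
    and N: "1 \<le> real (n choose 2) * (1 - p)" and F: "F \<subseteq> complete_arcs n"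
  shows "measure_pmf.prob (random_digraph n m) (avoiding F)
    \<le> 2 * (real (n choose 2) + 1) * (1 - p / 2) ^ card F"
proof -
  define N where "N = n choose 2"
  define x where "x = p / (1 - p)"
  have x0: "x > 0" using p by (simp add: x_def)
  have mN: "m \<le> N" using edge_count_le[OF p] m by (simp add: N_def)
  let ?S = "\<Sum>E\<in>simple_graphs n m. \<Prod>e\<in>E. edge_weight F e"
  have w: "x * edge_weight F e + 1 \<le> (1 + x) * (1 - p / 2) ^ card (orientations e \<inter> F)"
    if "e \<in> vertex_pairs n" for e
  proof -
    have *: "1 + x = 1 / (1 - p)" using p by (simp add: x_def field_simps)
    have "card (orientations e \<inter> F) \<in> {0, 1, 2}" using edge_weight_bounds[OF that, of F] by auto
    then have "1 - p + p * edge_weight F e \<le> (1 - p / 2) ^ card (orientations e \<inter> F)"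
      by (auto simp: edge_weight_def power2_eq_square algebra_simps)
    then have "(1 - p + p * edge_weight F e) / (1 - p) \<le> (1 - p / 2) ^ card (orientations e \<inter> F) / (1 - p)"
      using p by (intro divide_right_mono) auto
    moreover have "(1 - p + p * edge_weight F e) / (1 - p) = x * edge_weight F e + 1"
      using p by (simp add: x_def field_simps)
    ultimately show ?thesis unfolding * by simp
  qed
  have "x ^ m * ?S = (\<Sum>E\<in>simple_graphs n m. \<Prod>e\<in>E. x * edge_weight F e)"
    unfolding sum_distrib_left by (intro sum.cong) (auto simp: prod.distrib simple_graphs_def)
  also have "\<dots> \<le> (\<Sum>E\<in>Pow (vertex_pairs n). \<Prod>e\<in>E. x * edge_weight F e)"
    using x0 edge_weight_bounds(2) by (intro sum_mono2) (auto simp: simple_graphs_conv intro!: prod_nonneg)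
  also have "\<dots> = (\<Prod>e\<in>vertex_pairs n. x * edge_weight F e + 1)"
    by (subst prod_add) simp_all
  also have "\<dots> \<le> (\<Prod>e\<in>vertex_pairs n. (1 + x) * (1 - p / 2) ^ card (orientations e \<inter> F))"
    using w x0 edge_weight_bounds(2) by (intro prod_mono) auto
  also have "\<dots> = (1 + x) ^ N * (1 - p / 2) ^ card F"
    by (simp add: prod.distrib card_vertex_pairs N_def card_arcs_conv_sum[OF F] power_sum)
  also have "\<dots> \<le> 2 * (real N + 1) * (real (N choose m) * x ^ m) * (1 - p / 2) ^ card F"
    using power_le_binomial_mode[OF p m assms(4)] p
    by (intro mult_right_mono) (auto simp: x_def N_def)
  finally have "x ^ m * ?S \<le> x ^ m * (2 * (real N + 1) * (1 - p / 2) ^ card F * real (N choose m))"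
    by (simp only: mult_ac)
  then have "?S \<le> 2 * (real N + 1) * (1 - p / 2) ^ card F * real (N choose m)"
    using x0 by (subst (asm) mult_le_cancel_left_pos) simp_all
  moreover have "real (N choose m) > 0" using mN by simp
  ultimately show ?thesis using mN
    by (subst prob_avoiding) (auto simp: N_def divide_simps)
qed

lemma card_subsets_inter:
  assumes "finite U" "K \<subseteq> U" "j \<le> m"
  shows "card {E. E \<subseteq> U \<and> card E = m \<and> card (E \<inter> K) = j} =
    (card K choose j) * ((card U - card K) choose (m - j))"
proof -
  have fin: "finite K" "finite (U - K)" using assms finite_subset by auto
  let ?A = "{A. A \<subseteq> K \<and> card A = j}" and ?B = "{B. B \<subseteq> U - K \<and> card B = m - j}"
  have "bij_betw (\<lambda>(A, B). A \<union> B) (?A \<times> ?B) {E. E \<subseteq> U \<and> card E = m \<and> card (E \<inter> K) = j}"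
  proof (rule bij_betw_byWitness[where f' = "\<lambda>E. (E \<inter> K, E - K)"])
    show "(\<lambda>(A, B). A \<union> B) ` (?A \<times> ?B) \<subseteq> {E. E \<subseteq> U \<and> card E = m \<and> card (E \<inter> K) = j}"
    proof clarify
      fix A B assume AB: "A \<subseteq> K" "B \<subseteq> U - K" "j = card A" "card B = m - card A"
      then have "card (A \<union> B) = card A + card B"
        using fin by (intro card_Un_disjoint) (auto dest: finite_subset)
      moreover have "(A \<union> B) \<inter> K = A" using AB by blast
      ultimately show "A \<union> B \<subseteq> U \<and> card (A \<union> B) = m \<and> card ((A \<union> B) \<inter> K) = card A"
        using AB assms by auto
    qed
    show "(\<lambda>E. (E \<inter> K, E - K)) ` {E. E \<subseteq> U \<and> card E = m \<and> card (E \<inter> K) = j} \<subseteq> ?A \<times> ?B"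
      using fin by (auto simp: card_Diff_subset_Int)
  qed auto
  then have "card {E. E \<subseteq> U \<and> card E = m \<and> card (E \<inter> K) = j} = card (?A \<times> ?B)"
    by (simp add: bij_betw_same_card)
  also have "\<dots> = (card K choose j) * (card (U - K) choose (m - j))"
    using fin by (simp add: card_cartesian_product n_subsets)
  finally show ?thesis using assms fin by (simp add: card_Diff_subset)
qed

text \<open>As no pair has both orientations in \<open>F\<close>, each pair touched by
  \<open>F\<close> has weight 1/2 and every other pair weight 1. The product is thus a power of 1/2
  whose exponent, the number of touched edges, is hypergeometric; the edge sets are grouped by that
  number.\<close>

lemma prob_avoiding_single:
  assumes m: "m \<le> n choose 2" and F: "F \<subseteq> complete_arcs n" "\<And>u v. (u, v) \<in> F \<Longrightarrow> (v, u) \<notin> F"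
    and k: "card F \<le> m"
  shows "measure_pmf.prob (random_digraph n m) (avoiding F) = hypergeometric_half (n choose 2) m (card F)"
proof -
  define K where "K = {e \<in> vertex_pairs n. orientations e \<inter> F \<noteq> {}}"
  have KV: "K \<subseteq> vertex_pairs n" by (auto simp: K_def)
  have one: "card (orientations e \<inter> F) = (if e \<in> K then 1 else 0)" if e: "e \<in> vertex_pairs n" for e
  proof (cases "e \<in> K")
    case True
    obtain u v where uv: "e = {u, v}" "u \<noteq> v" using e by (rule vertex_pairsE)
    then have "orientations e \<inter> F = {(u, v)} \<or> orientations e \<inter> F = {(v, u)}"
      using True F(2)[of u v] by (auto simp: K_def orientations_doubleton)
    then show ?thesis using True by auto
  next
    case False
    then have "orientations e \<inter> F = {}" using e by (simp add: K_def)
    then show ?thesis using False by simp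
  qed
  have cK: "card K = card F"
  proof -
    have "card F = (\<Sum>e\<in>vertex_pairs n. if e \<in> K then 1 else 0)"
      unfolding card_arcs_conv_sum[OF F(1)] using one by (intro sum.cong) auto
    also have "\<dots> = card K" using KV by (simp add: sum.If_cases Int_absorb1)
    finally show ?thesis by simp
  qed
  have prod: "(\<Prod>e\<in>E. edge_weight F e) = (1/2) ^ card (E \<inter> K)" if "E \<in> simple_graphs n m" for E
  proof -
    have EV: "E \<subseteq> vertex_pairs n" and fin: "finite E"
      using that finite_subset[of E "vertex_pairs n"] by (auto simp: simple_graphs_conv)
    have "(\<Prod>e\<in>E. edge_weight F e) = (\<Prod>e\<in>E. if e \<in> K then 1/2 else 1)"
      using one EV by (intro prod.cong) (auto simp: edge_weight_def)
    also have "\<dots> = (1/2) ^ card (E \<inter> K)" using fin by (simp add: prod.If_cases)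
    finally show ?thesis .
  qed
  have finK: "finite K" using KV by (rule finite_subset) simp
  have "(\<Sum>E\<in>simple_graphs n m. \<Prod>e\<in>E. edge_weight F e) = (\<Sum>E\<in>simple_graphs n m. (1/2) ^ card (E \<inter> K))"
    using prod by (intro sum.cong) auto
  also have "\<dots> = (\<Sum>j\<le>card F. \<Sum>E\<in>{E \<in> simple_graphs n m. card (E \<inter> K) = j}. (1/2) ^ card (E \<inter> K))"
    using finK by (intro sum.group[symmetric]) (auto simp: finite_simple_graphs cK[symmetric] intro!: card_mono)
  also have "\<dots> = (\<Sum>j\<le>card F. real (card F choose j) * real ((n choose 2) - card F choose (m - j)) * (1/2) ^ j)"
  proof (intro sum.cong refl)
    fix j assume "j \<in> {..card F}"
    then have "j \<le> m" using k by simp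
    have "{E \<in> simple_graphs n m. card (E \<inter> K) = j} = {E. E \<subseteq> vertex_pairs n \<and> card E = m \<and> card (E \<inter> K) = j}"
      by (auto simp: simple_graphs_conv)
    then have "card {E \<in> simple_graphs n m. card (E \<inter> K) = j}
        = (card F choose j) * ((n choose 2) - card F choose (m - j))"
      using card_subsets_inter[OF finite_vertex_pairs KV \<open>j \<le> m\<close>] by (simp add: cK card_vertex_pairs)
    then show "(\<Sum>E\<in>{E \<in> simple_graphs n m. card (E \<inter> K) = j}. (1/2) ^ card (E \<inter> K)) =
       real (card F choose j) * real ((n choose 2) - card F choose (m - j)) * (1/2) ^ j"
      by simp
  qed
  finally show ?thesis using m by (simp add: prob_avoiding hypergeometric_half_def)
qed

section \<open>Vertex sets closed under out-arcs\<close>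

lemma random_digraph_support:
  assumes "m \<le> n choose 2" and G: "G \<in> set_pmf (random_digraph n m)"
  shows "pverts G = {1..n}" "parcs G \<subseteq> complete_arcs n"
proof -
  from G obtain E f where E: "E \<in> simple_graphs n m"
    and f: "f \<in> set_pmf (Pi_pmf E undefined (\<lambda>e. pmf_of_set (orientations e)))"
    and G': "G = \<lparr> pverts = {1..n}, parcs = f ` E \<rparr>"
    unfolding random_digraph_def
    by (auto simp: set_pmf_of_set[OF simple_graphs_nonempty[OF assms(1)] finite_simple_graphs])
  show "pverts G = {1..n}" by (simp add: G')
  have EV: "E \<subseteq> vertex_pairs n" using E by (simp add: simple_graphs_conv)
  then have fin: "finite E" by (rule finite_subset) simp
  have "f e \<in> orientations e" if "e \<in> E" for e
  proof -
    have e: "e \<in> vertex_pairs n" using EV that by blast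
    have "orientations e \<noteq> {}" using card_orientations(1)[OF e] by auto
    then have "set_pmf (pmf_of_set (orientations e)) = orientations e"
      using card_orientations(2)[OF e] by (rule set_pmf_of_set)
    moreover have "f e \<in> set_pmf (pmf_of_set (orientations e))"
      using f that by (auto simp: set_Pi_pmf[OF fin] PiE_dflt_def)
    ultimately show ?thesis by simp
  qed
  then show "parcs G \<subseteq> complete_arcs n" using EV unfolding complete_arcs_conv G' by auto
qed

definition boundary_arcs :: "nat \<Rightarrow> nat set \<Rightarrow> (nat \<times> nat) set" where
  "boundary_arcs n S = S \<times> ({1..n} - S)"

definition out_closed :: "nat \<Rightarrow> nat pair_pre_digraph \<Rightarrow> nat set \<Rightarrow> bool" where
  "out_closed n G S \<longleftrightarrow> S \<subseteq> {1..n} \<and> G \<in> avoiding (boundary_arcs n S)"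

text \<open>If no path exists, the set of vertices reachable from \<open>u\<close> is a closed set
  that omits \<open>v\<close>, since a walk to \<open>v\<close> could be shortened to a path.
  Conversely, induction along reachability shows that nothing outside a closed set can be reached
  from inside it.\<close>

lemma no_dipath_iff_out_closed:
  assumes G: "pverts G = {1..n}" "parcs G \<subseteq> complete_arcs n" and u: "u \<in> {1..n}"
  shows "G \<in> no_dipath u v \<longleftrightarrow> (\<exists>S. out_closed n G S \<and> u \<in> S \<and> v \<notin> S)"
proof
  interpret pair_wf_digraph G
    using G by unfold_locales (auto simp: complete_arcs_def)
  {
    assume nd: "G \<in> no_dipath u v"
    define S where "S = {w. u \<rightarrow>\<^sup>*\<^bsub>with_proj G\<^esub> w}"
    have "u \<in> S" using u G by (auto simp: S_def)
    moreover have "v \<notin> S"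
    proof
      assume "v \<in> S"
      then obtain P where "awalk u P v" by (auto simp: S_def reachable_awalk)
      then have "apath u (awalk_to_apath P) v" by (rule apath_awalk_to_apath)
      with nd show False by (auto simp: no_dipath_def)
    qed
    moreover have "S \<subseteq> {1..n}" using G reachable_in_verts(2) by (auto simp: S_def)
    moreover have "G \<in> avoiding (boundary_arcs n S)"
    proof -
      have "w' \<in> S" if "w \<in> S" "(w, w') \<in> parcs G" for w w'
        using that reachable_adj_trans[of u w w'] by (simp add: S_def)
      then show ?thesis by (auto simp: avoiding_def boundary_arcs_def)
    qed
    ultimately show "\<exists>S. out_closed n G S \<and> u \<in> S \<and> v \<notin> S" unfolding out_closed_def by blast
  next
    assume "\<exists>S. out_closed n G S \<and> u \<in> S \<and> v \<notin> S"
    then obtain S where S: "S \<subseteq> {1..n}" "parcs G \<inter> boundary_arcs n S = {}" "u \<in> S" "v \<notin> S"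
      by (auto simp: out_closed_def avoiding_def)
    have "w \<in> S" if "u \<rightarrow>\<^sup>*\<^bsub>with_proj G\<^esub> w" for w
      using that
    proof (induction rule: reachable_induct)
      case (step x z)
      then have "(x, z) \<in> parcs G" by simp
      moreover from this have "z \<in> {1..n}" using G by (auto simp: complete_arcs_def)
      ultimately show ?case using S(2) step by (auto simp: boundary_arcs_def)
    qed (use S in auto)
    then have "\<not> u \<rightarrow>\<^sup>*\<^bsub>with_proj G\<^esub> v" using S by blast
    then show "G \<in> no_dipath u v"
      using awalkI_apath reachable_awalk unfolding no_dipath_def by blast
  }
qed

lemma out_closed_iff:
  "out_closed n G S \<longleftrightarrow> S \<subseteq> {1..n} \<and> (\<forall>u\<in>S. \<forall>v\<in>{1..n}. (u, v) \<in> parcs G \<longrightarrow> v \<in> S)"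
  unfolding out_closed_def avoiding_def boundary_arcs_def by auto

lemma out_closed_Un: "out_closed n G S \<Longrightarrow> out_closed n G T \<Longrightarrow> out_closed n G (S \<union> T)"
  and out_closed_Int: "out_closed n G S \<Longrightarrow> out_closed n G T \<Longrightarrow> out_closed n G (S \<inter> T)"
  unfolding out_closed_iff by auto

section \<open>Negligible and extremal configurations of closed sets\<close>

definition middle_closed :: "nat \<Rightarrow> nat pair_pre_digraph set" where
  "middle_closed n = {G. \<exists>S. out_closed n G S \<and> 3 \<le> card S \<and> card S + 3 \<le> n}"

text \<open>The bound 3 excludes exactly the case of two singletons: a closed \<open>{x}\<close>
  with a closed complement of \<open>{z}\<close>, \<open>x \<noteq> z\<close>, forbids only
  \<open>2 n - 3\<close> arcs and belongs to the main term.\<close>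

definition mixed_closed :: "nat \<Rightarrow> nat pair_pre_digraph set" where
  "mixed_closed n = {G. \<exists>S W. out_closed n G S \<and> W \<subseteq> {1..n} \<and> out_closed n G ({1..n} - W) \<and>
     card S \<in> {1, 2} \<and> card W \<in> {1, 2} \<and> 3 \<le> card S + card W}"

text \<open>For indices 0 and 1 a single closed set separates \<open>s\<close> from \<open>a\<close>
  and \<open>t\<close> from \<open>b\<close>. For index 2, \<open>{s}\<close> blocks the paths to
  \<open>a\<close> and the complement of \<open>{b}\<close> blocks those from \<open>t\<close>;
  index 3 exchanges the roles.\<close>

definition extremal_forbidden :: "nat \<Rightarrow> nat \<Rightarrow> nat \<Rightarrow> nat \<Rightarrow> nat \<Rightarrow> nat \<Rightarrow> (nat \<times> nat) set" where
  "extremal_forbidden n a s b t i =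
    (if i = 0 then boundary_arcs n {s, t}
     else if i = 1 then boundary_arcs n ({1..n} - {a, b})
     else if i = 2 then boundary_arcs n {s} \<union> boundary_arcs n ({1..n} - {b})
     else boundary_arcs n {t} \<union> boundary_arcs n ({1..n} - {a}))"

lemma extremal_forbidden_simps:
  "extremal_forbidden n a s b t 0 = boundary_arcs n {s, t}"
  "extremal_forbidden n a s b t 1 = boundary_arcs n ({1..n} - {a, b})"
  "extremal_forbidden n a s b t 2 = boundary_arcs n {s} \<union> boundary_arcs n ({1..n} - {b})"
  "extremal_forbidden n a s b t 3 = boundary_arcs n {t} \<union> boundary_arcs n ({1..n} - {a})"
  by (simp_all add: extremal_forbidden_def)

context
  fixes n a s b t :: nat
  assumes V: "{a, s, b, t} \<subseteq> {1..n}" and dist: "distinct [a, s, b, t]"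
begin

private abbreviation "extremal i \<equiv> avoiding (extremal_forbidden n a s b t i)"

lemma extremal_iff:
  "G \<in> extremal 0 \<longleftrightarrow> out_closed n G {s, t}"
  "G \<in> extremal 1 \<longleftrightarrow> out_closed n G ({1..n} - {a, b})"
  "G \<in> extremal 2 \<longleftrightarrow> out_closed n G {s} \<and> out_closed n G ({1..n} - {b})"
  "G \<in> extremal 3 \<longleftrightarrow> out_closed n G {t} \<and> out_closed n G ({1..n} - {a})"
  using V by (auto simp: extremal_forbidden_def out_closed_def avoiding_def)

lemma extremal_imp_no_dipath:
  assumes G: "pverts G = {1..n}" "parcs G \<subseteq> complete_arcs n" and "i \<in> {0, 1, 2, 3}" "G \<in> extremal i"
  shows "G \<in> no_dipath s a \<inter> no_dipath t b"
proof -
  have *: "G \<in> no_dipath s a \<longleftrightarrow> (\<exists>S. out_closed n G S \<and> s \<in> S \<and> a \<notin> S)"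
    "G \<in> no_dipath t b \<longleftrightarrow> (\<exists>S. out_closed n G S \<and> t \<in> S \<and> b \<notin> S)"
    using V by (intro no_dipath_iff_out_closed[OF G]; simp)+
  have "(\<exists>S. out_closed n G S \<and> s \<in> S \<and> a \<notin> S) \<and> (\<exists>S. out_closed n G S \<and> t \<in> S \<and> b \<notin> S)"
  proof -
    have V': "a \<in> {1..n}" "s \<in> {1..n}" "b \<in> {1..n}" "t \<in> {1..n}" using V by auto
    have ne: "a \<noteq> s" "a \<noteq> b" "a \<noteq> t" "s \<noteq> b" "s \<noteq> t" "b \<noteq> t" using dist by auto
    consider "i = 0" | "i = 1" | "i = 2" | "i = 3" using assms(3) by blast
    then show ?thesis
    proof cases
      case 1
      then have "out_closed n G {s, t}" using assms(4) by (simp only: extremal_iff)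
      then show ?thesis using ne by blast
    next
      case 2
      then have "out_closed n G ({1..n} - {a, b})" using assms(4) by (simp only: extremal_iff)
      then show ?thesis using ne V' by blast
    next
      case 3
      then have "out_closed n G {s}" "out_closed n G ({1..n} - {b})" using assms(4) by (simp_all only: extremal_iff)
      then show ?thesis using ne V' by blast
    next
      case 4
      then have "out_closed n G {t}" "out_closed n G ({1..n} - {a})" using assms(4) by (simp_all only: extremal_iff)
      then show ?thesis using ne V' by blast
    qed
  qed
  then show ?thesis using * by simp
qed

text \<open>Take closed sets \<open>S\<close> and \<open>T\<close> separating the two pairs. Outside
  \<open>middle_closed\<close> each has at most two elements or misses at most two. If both are
  small, their union is closed and small, hence \<open>{s, t}\<close>; if both are co-small, their
  intersection is the complement of \<open>{a, b}\<close>. If one is of each kind, the absence of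
  \<open>mixed_closed\<close> leaves a singleton and the complement of a singleton.\<close>

lemma no_dipath_imp_extremal:
  assumes G: "pverts G = {1..n}" "parcs G \<subseteq> complete_arcs n"
    and nd: "G \<in> no_dipath s a \<inter> no_dipath t b"
    and err: "G \<notin> middle_closed n" "G \<notin> mixed_closed n" and n: "7 \<le> n"
  shows "\<exists>i\<in>{0, 1, 2, 3}. G \<in> extremal i"
proof -
  obtain S T where S: "out_closed n G S" "s \<in> S" "a \<notin> S" and T: "out_closed n G T" "t \<in> T" "b \<notin> T"
    using nd no_dipath_iff_out_closed[OF G, of s a] no_dipath_iff_out_closed[OF G, of t b] V by auto
  have sub: "S \<subseteq> {1..n}" "T \<subseteq> {1..n}" using S T by (auto simp: out_closed_def)
  then have fin: "finite S" "finite T" using finite_subset by blast+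
  have small: "card X \<le> 2 \<or> card ({1..n} - X) \<le> 2" if "out_closed n G X" for X
  proof -
    have "X \<subseteq> {1..n}" using that by (simp add: out_closed_def)
    then have "card ({1..n} - X) = n - card X"
      using finite_subset[of X "{1..n}"] by (simp add: card_Diff_subset)
    moreover have "\<not> (3 \<le> card X \<and> card X + 3 \<le> n)"
      using err that unfolding middle_closed_def by blast
    ultimately show ?thesis by linarith
  qed
  have single: "X = {x}" if "x \<in> X" "card X = 1" for x and X :: "nat set"
    using that by (metis card_1_singletonE singletonD)
  have pos: "card X \<ge> 1" if "x \<in> X" "finite X" for x and X :: "nat set"
    using that by (metis One_nat_def Suc_leI card_gt_0_iff empty_iff)
  have mixed: "X = {x} \<and> {1..n} - Y = {z}"
    if "out_closed n G X" "out_closed n G Y" "card X \<le> 2" "card ({1..n} - Y) \<le> 2"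
       "x \<in> X" "z \<in> {1..n} - Y" for X Y x z
  proof -
    have X: "X \<subseteq> {1..n}" "Y \<subseteq> {1..n}" using that by (auto simp: out_closed_def)
    then have "card X \<ge> 1" "card ({1..n} - Y) \<ge> 1"
      using that pos finite_subset[of X "{1..n}"] by (auto intro!: pos)
    moreover have "{1..n} - ({1..n} - Y) = Y" using X by blast
    then have "\<not> (card X \<in> {1, 2} \<and> card ({1..n} - Y) \<in> {1, 2} \<and> 3 \<le> card X + card ({1..n} - Y))"
      using err(2) that unfolding mixed_closed_def
      by (metis (mono_tags, lifting) Diff_subset mem_Collect_eq)
    ultimately have "card X = 1" "card ({1..n} - Y) = 1" using that by auto
    then show ?thesis using single[OF that(5)] single[OF that(6)] by blast
  qed
  consider "card S \<le> 2" "card T \<le> 2" | "card ({1..n} - S) \<le> 2" "card ({1..n} - T) \<le> 2"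
    | "card S \<le> 2" "card ({1..n} - T) \<le> 2" | "card ({1..n} - S) \<le> 2" "card T \<le> 2"
    using small S T by blast
  then show ?thesis
  proof cases
    case 1
    have cl: "out_closed n G (S \<union> T)" using S T out_closed_Un by blast
    have "card (S \<union> T) \<le> 4" using card_Un_le[of S T] 1 by linarith
    \<comment> \<open>A union of 3 or 4 elements would be a middle closed set, because
      \<open>4 + 3 \<le> n\<close>.\<close>
    then have "card (S \<union> T) \<le> 2" using cl err(1) n unfolding middle_closed_def by fastforce
    moreover have "card {s, t} = 2" using dist by simp
    ultimately have "{s, t} = S \<union> T" using S T fin by (intro card_seteq) auto
    then have "G \<in> extremal 0" using cl by (simp only: extremal_iff)
    then show ?thesis by blast
  next
    case 2
    have cl: "out_closed n G (S \<inter> T)" using S T out_closed_Int by blast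
    define W where "W = ({1..n} - S) \<union> ({1..n} - T)"
    have W: "W \<subseteq> {1..n}" "S \<inter> T = {1..n} - W" using sub by (auto simp: W_def)
    have "card W \<le> 4" unfolding W_def using card_Un_le[of "{1..n} - S" "{1..n} - T"] 2 by linarith
    moreover have "card (S \<inter> T) = n - card W"
      using W finite_subset[of W "{1..n}"] by (simp add: card_Diff_subset)
    ultimately have "card W \<le> 2" using cl err(1) n unfolding middle_closed_def by fastforce
    moreover have "card {a, b} = 2" using dist by simp
    ultimately have "{a, b} = W" using S T V by (intro card_seteq) (auto simp: W_def)
    then have "G \<in> extremal 1" using cl W by (simp only: extremal_iff)
    then show ?thesis by blast
  next
    case 3
    then have "S = {s}" "{1..n} - T = {b}" using mixed[of S T s b] S T V by auto
    moreover from this sub have "T = {1..n} - {b}" by auto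
    ultimately have "G \<in> extremal 2" using S T by (simp only: extremal_iff)
    then show ?thesis by blast
  next
    case 4
    then have "T = {t}" "{1..n} - S = {a}" using mixed[of T S t a] S T V by auto
    moreover from this sub have "S = {1..n} - {a}" by auto
    ultimately have "G \<in> extremal 3" using S T by (simp only: extremal_iff)
    then show ?thesis by blast
  qed
qed

text \<open>Any two of the four events together supply a small closed set and a co-small one of
  total (co)size at least 3. For indices 2 and 3 the small set is the union \<open>{s, t}\<close> of
  the two closed singletons.\<close>

lemma extremal_disjoint:
  assumes "G \<in> extremal i" "G \<in> extremal j" "i \<in> {0, 1, 2, 3}" "j \<in> {0, 1, 2, 3}" "i < j"
  shows "G \<in> mixed_closed n"
proof -
  have mixed: "G \<in> mixed_closed n"
    if "out_closed n G S" "out_closed n G ({1..n} - W)" "W \<subseteq> {1..n}"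
      "card S \<in> {1, 2}" "card W \<in> {1, 2}" "3 \<le> card S + card W" for S W
    using that unfolding mixed_closed_def by blast
  have c: "card {s, t} = 2" "card {a, b} = 2" "card {x} = 1" for x :: nat using dist by auto
  have Un: "out_closed n G {s, t}" if "out_closed n G {s}" "out_closed n G {t}"
    using out_closed_Un[OF that] by (simp add: insert_commute)
  have sub: "{a, b} \<subseteq> {1..n}" "{b} \<subseteq> {1..n}" "{a} \<subseteq> {1..n}" using V by auto
  consider "i = 0" "j = 1" | "i = 0" "j = 2" | "i = 0" "j = 3" | "i = 1" "j = 2" | "i = 1" "j = 3" | "i = 2" "j = 3"
    using assms(3-5) by auto
  then show ?thesis
  proof cases
    case 1
    with assms(1,2) show ?thesis using sub c by (intro mixed[of "{s, t}" "{a, b}"]) (simp_all only: extremal_iff, auto)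
  next
    case 2
    with assms(1,2) show ?thesis using sub c by (intro mixed[of "{s, t}" "{b}"]) (simp_all only: extremal_iff, auto)
  next
    case 3
    with assms(1,2) show ?thesis using sub c by (intro mixed[of "{s, t}" "{a}"]) (simp_all only: extremal_iff, auto)
  next
    case 4
    with assms(1,2) show ?thesis using sub c by (intro mixed[of "{s}" "{a, b}"]) (simp_all only: extremal_iff, auto)
  next
    case 5
    with assms(1,2) show ?thesis using sub c by (intro mixed[of "{t}" "{a, b}"]) (simp_all only: extremal_iff, auto)
  next
    case 6
    with assms(1,2) show ?thesis using sub c Un by (intro mixed[of "{s, t}" "{b}"]) (simp_all only: extremal_iff, auto)
  qed
qed

text \<open>These are the requirements of \<open>prob_avoiding_single\<close>. Opposite arcs could
  only come from two different boundaries, one leaving \<open>x\<close> and the reverse one entering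
  \<open>z\<close>; that would force \<open>x = z\<close>.\<close>

lemma extremal_forbidden_arcs:
  assumes "i \<in> {0, 1, 2, 3}"
  shows "extremal_forbidden n a s b t i \<subseteq> complete_arcs n"
    and "(u, v) \<in> extremal_forbidden n a s b t i \<Longrightarrow> (v, u) \<notin> extremal_forbidden n a s b t i"
proof -
  have V': "a \<in> {1..n}" "s \<in> {1..n}" "b \<in> {1..n}" "t \<in> {1..n}" using V by auto
  have sub: "boundary_arcs n S \<subseteq> complete_arcs n" if "S \<subseteq> {1..n}" for S
    using that unfolding boundary_arcs_def complete_arcs_def by blast
  show "extremal_forbidden n a s b t i \<subseteq> complete_arcs n"
    unfolding extremal_forbidden_def using V' by (simp add: sub)
  have anti: "(v, u) \<notin> boundary_arcs n S" if "(u, v) \<in> boundary_arcs n S" for S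
    using that unfolding boundary_arcs_def by blast
  have anti2: "(v, u) \<notin> boundary_arcs n {x} \<union> boundary_arcs n ({1..n} - {z})"
    if "(u, v) \<in> boundary_arcs n {x} \<union> boundary_arcs n ({1..n} - {z})" "x \<noteq> z" for x z
    using that unfolding boundary_arcs_def by blast
  have ne: "s \<noteq> b" "t \<noteq> a" using dist by auto
  show "(v, u) \<notin> extremal_forbidden n a s b t i" if "(u, v) \<in> extremal_forbidden n a s b t i"
  proof -
    consider "i = 0" | "i = 1" | "i = 2" | "i = 3" using assms by blast
    then show ?thesis
      using that anti anti2[OF _ ne(1)] anti2[OF _ ne(2)]
      by cases (simp_all only: extremal_forbidden_simps, blast+)
  qed
qed

lemma card_extremal_forbidden:
  "card (extremal_forbidden n a s b t 0) = 2 * n - 4"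
  "card (extremal_forbidden n a s b t 1) = 2 * n - 4"
  "card (extremal_forbidden n a s b t 2) = 2 * n - 3"
  "card (extremal_forbidden n a s b t 3) = 2 * n - 3"
proof -
  have star: "card (boundary_arcs n {x} \<union> boundary_arcs n ({1..n} - {z})) = 2 * n - 3"
    if "x \<in> {1..n}" "z \<in> {1..n}" "x \<noteq> z" for x z
  proof -
    \<comment> \<open>The arc \<open>(x, z)\<close> lies in both boundaries of \<open>n - 1\<close>
      arcs each. Counting it once gives \<open>2 n - 3\<close>.\<close>
    have "boundary_arcs n {x} \<union> boundary_arcs n ({1..n} - {z}) = {x} \<times> ({1..n} - {x}) \<union> ({1..n} - {x, z}) \<times> {z}"
      using that by (auto simp: boundary_arcs_def)
    also have "card \<dots> = card ({x} \<times> ({1..n} - {x})) + card (({1..n} - {x, z}) \<times> {z})"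
      by (intro card_Un_disjoint) auto
    also have "\<dots> = (n - 1) + (n - 2)"
      using that by (simp add: card_cartesian_product card_Diff_subset)
    finally show ?thesis using that by auto
  qed
  have pair: "card ({1..n} - {x, z}) = n - 2" if "x \<in> {1..n}" "z \<in> {1..n}" "x \<noteq> z" for x z
    using that by (simp add: card_Diff_subset)
  have V': "a \<in> {1..n}" "s \<in> {1..n}" "b \<in> {1..n}" "t \<in> {1..n}" using V by auto
  have ne: "a \<noteq> b" "s \<noteq> t" "s \<noteq> b" "t \<noteq> a" using dist by auto
  have "{1..n} - ({1..n} - {a, b}) = {a, b}" using V' by blast
  then have "extremal_forbidden n a s b t 1 = ({1..n} - {a, b}) \<times> {a, b}"
    unfolding extremal_forbidden_def boundary_arcs_def by simp
  then show "card (extremal_forbidden n a s b t 1) = 2 * n - 4"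
    using pair[OF V'(1,3) ne(1)] ne(1) by (simp only: card_cartesian_product) simp
  have "extremal_forbidden n a s b t 0 = {s, t} \<times> ({1..n} - {s, t})"
    unfolding extremal_forbidden_def boundary_arcs_def by simp
  then show "card (extremal_forbidden n a s b t 0) = 2 * n - 4"
    using pair[OF V'(2,4) ne(2)] ne(2) by (simp only: card_cartesian_product) simp
  show "card (extremal_forbidden n a s b t 2) = 2 * n - 3" "card (extremal_forbidden n a s b t 3) = 2 * n - 3"
    using star[OF V'(2,3) ne(3)] star[OF V'(4,1) ne(4)] by (simp_all add: extremal_forbidden_def)
qed

end

lemma boundary_arcs_subset: "S \<subseteq> {1..n} \<Longrightarrow> boundary_arcs n S \<subseteq> complete_arcs n"
  unfolding boundary_arcs_def complete_arcs_def by blast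

lemma card_boundary_arcs:
  assumes "S \<subseteq> {1..n}"
  shows "card (boundary_arcs n S) = card S * (n - card S)"
  using assms finite_subset[OF assms]
  by (simp add: boundary_arcs_def card_cartesian_product card_Diff_subset)

section \<open>Probability estimates\<close>

text \<open>By symmetry \<open>2 k \<le> n\<close> may be assumed. With \<open>k = 3 + i\<close> and
  \<open>n - k = 3 + v\<close> the exponent is \<open>3 (n - 3) + i v\<close>, so each element
  beyond the third costs a factor at most \<open>n\<close> in the binomial coefficient and gains
  \<open>y ^ v\<close>, where \<open>v\<close> is at least \<open>(n - 6) div 2\<close>. By
  assumption this product is at most 1.\<close>

lemma binomial_power_le:
  fixes y :: real
  assumes y: "0 \<le> y" "y \<le> 1" and n: "real n * y ^ ((n - 6) div 2) \<le> 1" and k: "3 \<le> k" "k + 3 \<le> n"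
  shows "real (n choose k) * y ^ (k * (n - k)) \<le> real n ^ 3 * y ^ (3 * (n - 3))"
proof -
  have half: "real (n choose k) * y ^ (k * (n - k)) \<le> real n ^ 3 * y ^ (3 * (n - 3))"
    if k: "3 \<le> k" "2 * k \<le> n" for k
  proof -
    obtain i where i: "k = 3 + i" using k(1) le_Suc_ex by blast
    obtain v where v: "n = 6 + i + v" "i \<le> v"
      using k(2) i by (intro that[of "n - 6 - i"]) auto
    define d where "d = (n - 6) div 2"
    have "d \<le> v" using v by (simp add: d_def)
    then have "i * d \<le> i * v" by simp
    moreover have "k * (n - k) = 3 * (n - 3) + i * v" using i v by (simp add: algebra_simps)
    ultimately have le: "3 * (n - 3) + d * i \<le> k * (n - k)" by (simp add: mult.commute)
    have "real (n choose k) \<le> real (n ^ k)"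
      using binomial_le_pow[of k n] k by (simp only: of_nat_le_iff)
    moreover have "y ^ (k * (n - k)) \<le> y ^ (3 * (n - 3) + d * i)" using le y by (rule power_decreasing)
    ultimately have "real (n choose k) * y ^ (k * (n - k)) \<le> real (n ^ k) * y ^ (3 * (n - 3) + d * i)"
      using y by (intro mult_mono) auto
    also have "\<dots> = real n ^ 3 * y ^ (3 * (n - 3)) * (real n * y ^ d) ^ i"
      by (simp add: i power_add power_mult power_mult_distrib)
    also have "\<dots> \<le> real n ^ 3 * y ^ (3 * (n - 3)) * 1"
      using y n by (intro mult_left_mono power_le_one) (auto simp: d_def)
    finally show ?thesis by simp
  qed
  show ?thesis
  proof (cases "2 * k \<le> n")
    case False
    have kn: "k \<le> n" using k by simp
    have "real (n choose (n - k)) * y ^ ((n - k) * (n - (n - k))) \<le> real n ^ 3 * y ^ (3 * (n - 3))"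
      using False k by (intro half) auto
    then show ?thesis using kn by (simp add: binomial_symmetric[OF kn, symmetric] mult.commute)
  qed (use k half in auto)
qed

lemma prob_middle_closed_le:
  fixes p :: real
  assumes p: "0 < p" "p < 1" and m: "m = nat \<lfloor>p * real (n choose 2)\<rfloor>"
    and N: "1 \<le> real (n choose 2) * (1 - p)" and n: "real n * (1 - p / 2) ^ ((n - 6) div 2) \<le> 1"
  shows "measure_pmf.prob (random_digraph n m) (middle_closed n)
    \<le> 2 * (real (n choose 2) + 1) * real n ^ 4 * (1 - p / 2) ^ (3 * (n - 3))"
proof -
  let ?P = "measure_pmf.prob (random_digraph n m)"
  define c where "c = 2 * (real (n choose 2) + 1)"
  have c0: "c \<ge> 0" by (simp add: c_def)
  define y where "y = 1 - p / 2"
  have y01: "0 \<le> y" "y \<le> 1" using p by (auto simp: y_def)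
  define K where "K = {k. 3 \<le> k \<and> k + 3 \<le> n}"
  define Q where "Q k = {S. S \<subseteq> {1..n} \<and> card S = k}" for k
  have K: "K \<subseteq> {1..n}" by (auto simp: K_def)
  then have finK: "finite K" and cK: "card K \<le> n"
    using finite_subset card_mono[OF _ K] by auto
  have finQ: "finite (Q k)" for k unfolding Q_def by (rule finite_subset[of _ "Pow {1..n}"]) auto
  have cQ: "card (Q k) = n choose k" for k unfolding Q_def using n_subsets[of "{1..n}" k] by simp
  have "?P (middle_closed n) \<le> ?P (\<Union>k\<in>K. \<Union>S\<in>Q k. avoiding (boundary_arcs n S))"
    by (intro measure_pmf.finite_measure_mono) (auto simp: middle_closed_def out_closed_def K_def Q_def)
  also have "\<dots> \<le> (\<Sum>k\<in>K. ?P (\<Union>S\<in>Q k. avoiding (boundary_arcs n S)))"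
    using finK by (intro measure_pmf.finite_measure_subadditive_finite) auto
  also have "\<dots> \<le> (\<Sum>k\<in>K. c * (real n ^ 3 * y ^ (3 * (n - 3))))"
  proof (rule sum_mono)
    fix k assume k: "k \<in> K"
    have "?P (\<Union>S\<in>Q k. avoiding (boundary_arcs n S)) \<le> (\<Sum>S\<in>Q k. ?P (avoiding (boundary_arcs n S)))"
      using finQ by (intro measure_pmf.finite_measure_subadditive_finite) auto
    also have "\<dots> \<le> (\<Sum>S\<in>Q k. c * y ^ (k * (n - k)))"
    proof (rule sum_mono)
      fix S assume "S \<in> Q k"
      then have S: "S \<subseteq> {1..n}" "card S = k" by (auto simp: Q_def)
      show "?P (avoiding (boundary_arcs n S)) \<le> c * y ^ (k * (n - k))"
        using prob_avoiding_le[OF p m N boundary_arcs_subset[OF S(1)]] card_boundary_arcs[OF S(1)]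
        by (simp add: S(2) c_def y_def)
    qed
    also have "\<dots> = c * (real (n choose k) * y ^ (k * (n - k)))" by (simp add: cQ)
    also have "\<dots> \<le> c * (real n ^ 3 * y ^ (3 * (n - 3)))"
      using c0 k n y01 by (intro mult_left_mono binomial_power_le) (auto simp: K_def y_def)
    finally show "?P (\<Union>S\<in>Q k. avoiding (boundary_arcs n S)) \<le> c * (real n ^ 3 * y ^ (3 * (n - 3)))" .
  qed
  also have "\<dots> = real (card K) * (c * (real n ^ 3 * y ^ (3 * (n - 3))))" by simp
  also have "\<dots> \<le> real n * (c * (real n ^ 3 * y ^ (3 * (n - 3))))"
    using cK c0 y01 by (intro mult_right_mono) auto
  also have "\<dots> = c * real n ^ 4 * y ^ (3 * (n - 3))" by (simp add: power3_eq_cube power4_eq_xxxx)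
  finally show ?thesis by (simp add: c_def y_def)
qed

text \<open>The arcs from \<open>S\<close> to the vertices outside \<open>S \<union> W\<close> and
  the arcs entering \<open>W\<close> are disjoint families. Sizes 1 and 2 give at least
  \<open>3 n - 7\<close> arcs for large \<open>n\<close>, and two pairs give
  \<open>4 n - 12\<close>; the constant 12 covers all cases, also when \<open>S\<close> and
  \<open>W\<close> meet.\<close>

lemma card_mixed_boundary:
  assumes S: "S \<subseteq> {1..n}" "card S \<in> {1, 2}" and W: "W \<subseteq> {1..n}" "card W \<in> {1, 2}"
    and ge: "3 \<le> card S + card W"
  shows "3 * n \<le> card (boundary_arcs n S \<union> boundary_arcs n ({1..n} - W)) + 12"
proof -
  have fin: "finite S" "finite W" using S W finite_subset by blast+
  let ?X = "S \<times> ({1..n} - (S \<union> W))" and ?Y = "({1..n} - W) \<times> W"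
  have "card (S \<union> W) \<le> card S + card W" by (rule card_Un_le)
  then have X: "n - (card S + card W) \<le> card ({1..n} - (S \<union> W))"
    using fin S W by (subst card_Diff_subset) auto
  have Y: "card ({1..n} - W) = n - card W" using fin W by (simp add: card_Diff_subset)
  have "card ?X + card ?Y = card (?X \<union> ?Y)"
    using fin by (intro card_Un_disjoint[symmetric]) auto
  also have "\<dots> \<le> card (boundary_arcs n S \<union> boundary_arcs n ({1..n} - W))"
    using fin W by (intro card_mono) (auto simp: boundary_arcs_def)
  finally have "card S * card ({1..n} - (S \<union> W)) + (n - card W) * card W
      \<le> card (boundary_arcs n S \<union> boundary_arcs n ({1..n} - W))"
    using Y by (simp add: card_cartesian_product)
  moreover have "card S * (n - (card S + card W)) \<le> card S * card ({1..n} - (S \<union> W))"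
    using X by simp
  moreover have "3 * n \<le> card S * (n - (card S + card W)) + (n - card W) * card W + 12"
    using S(2) W(2) ge by auto
  ultimately show ?thesis by linarith
qed

lemma prob_mixed_closed_le:
  fixes p :: real
  assumes p: "0 < p" "p < 1" and m: "m = nat \<lfloor>p * real (n choose 2)\<rfloor>"
    and N: "1 \<le> real (n choose 2) * (1 - p)"
  shows "measure_pmf.prob (random_digraph n m) (mixed_closed n)
    \<le> 2 * (real (n choose 2) + 1) * real n ^ 4 * (1 - p / 2) ^ (3 * n - 12)"
proof -
  let ?P = "measure_pmf.prob (random_digraph n m)"
  define c where "c = 2 * (real (n choose 2) + 1)"
  have c0: "c \<ge> 0" by (simp add: c_def)
  define y where "y = 1 - p / 2"
  have y01: "0 \<le> y" "y \<le> 1" using p by (auto simp: y_def)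
  define Q where "Q = {S. S \<subseteq> {1..n} \<and> card S \<in> {1, 2}}"
  define R where "R = {(S, W). S \<in> Q \<and> W \<in> Q \<and> 3 \<le> card S + card W}"
  \<comment> \<open>Ordered pairs with a possible repetition cover both sizes, so there are at most
    \<open>n^2\<close> such sets and at most \<open>n^4\<close> pairs of them.\<close>
  have "Q \<subseteq> (\<lambda>(u, v). {u, v}) ` ({1..n} \<times> {1..n})"
  proof
    fix S assume "S \<in> Q"
    then have "S \<subseteq> {1..n}" "card S = 1 \<or> card S = 2" by (auto simp: Q_def)
    then obtain u v where "S = {u, v}" "u \<in> {1..n}" "v \<in> {1..n}"
      by (auto simp: card_1_singleton_iff card_2_iff)
    then show "S \<in> (\<lambda>(u, v). {u, v}) ` ({1..n} \<times> {1..n})" by auto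
  qed
  then have finQ: "finite Q" and "card Q \<le> card ((\<lambda>(u, v). {u, v}) ` ({1..n} \<times> {1..n}))"
    by (rule finite_subset card_mono[rotated]; simp)+
  moreover have "card ((\<lambda>(u, v). {u, v}) ` ({1..n} \<times> {1..n})) \<le> card ({1..n} \<times> {1..n})"
    by (rule card_image_le) simp
  ultimately have cQ: "card Q \<le> n ^ 2" by (simp add: card_cartesian_product power2_eq_square)
  have RQ: "R \<subseteq> Q \<times> Q" by (auto simp: R_def)
  then have finR: "finite R" using finQ finite_subset by blast
  have "card R \<le> card (Q \<times> Q)" using RQ finQ by (intro card_mono) auto
  also have "\<dots> \<le> n ^ 2 * n ^ 2" unfolding card_cartesian_product using cQ by (rule mult_le_mono) (rule cQ)
  finally have "card R \<le> n ^ 4" by (simp flip: power_add)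
  then have cR: "real (card R) \<le> real n ^ 4" by (simp flip: of_nat_power)
  define F where "F = (\<lambda>(S, W). boundary_arcs n S \<union> boundary_arcs n ({1..n} - W))"
  have "?P (mixed_closed n) \<le> ?P (\<Union>X\<in>R. avoiding (F X))"
  proof (rule measure_pmf.finite_measure_mono)
    show "mixed_closed n \<subseteq> (\<Union>X\<in>R. avoiding (F X))"
    proof
      fix G assume "G \<in> mixed_closed n"
      then obtain S W where SW: "out_closed n G S" "W \<subseteq> {1..n}" "out_closed n G ({1..n} - W)"
        "card S \<in> {1, 2}" "card W \<in> {1, 2}" "3 \<le> card S + card W"
        unfolding mixed_closed_def by blast
      then have "(S, W) \<in> R" by (simp add: R_def Q_def out_closed_def)
      moreover have "G \<in> avoiding (F (S, W))"
        using SW(1,3) by (simp add: F_def out_closed_def avoiding_def Int_Un_distrib)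
      ultimately show "G \<in> (\<Union>X\<in>R. avoiding (F X))" by blast
    qed
  qed simp
  also have "\<dots> \<le> (\<Sum>X\<in>R. ?P (avoiding (F X)))"
    using finR by (intro measure_pmf.finite_measure_subadditive_finite) auto
  also have "\<dots> \<le> (\<Sum>X\<in>R. c * y ^ (3 * n - 12))"
  proof (rule sum_mono)
    fix X assume X: "X \<in> R"
    obtain S W where XSW: "X = (S, W)" by (cases X)
    then have SW: "S \<subseteq> {1..n}" "card S \<in> {1, 2}" "W \<subseteq> {1..n}" "card W \<in> {1, 2}" "3 \<le> card S + card W"
      using X by (simp_all add: R_def Q_def)
    have "F X \<subseteq> complete_arcs n" unfolding F_def XSW using SW by (simp add: boundary_arcs_subset)
    from prob_avoiding_le[OF p m N this] have "?P (avoiding (F X)) \<le> c * y ^ card (F X)"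
      by (simp add: c_def y_def)
    also have "\<dots> \<le> c * y ^ (3 * n - 12)"
      using card_mixed_boundary[OF SW] c0 y01
      by (intro mult_left_mono power_decreasing) (auto simp: F_def XSW)
    finally show "?P (avoiding (F X)) \<le> c * y ^ (3 * n - 12)" .
  qed
  also have "\<dots> = real (card R) * (c * y ^ (3 * n - 12))" by simp
  also have "\<dots> \<le> real n ^ 4 * (c * y ^ (3 * n - 12))"
    using cR c0 y01 by (intro mult_right_mono) auto
  finally show ?thesis by (simp add: c_def y_def mult_ac)
qed

text \<open>The upper estimate is a union bound over the four extremal events and the negligible
  one. For the lower estimate the negligible event is removed from each extremal event: this makes
  them disjoint and costs its probability once per event, hence the factor 4.\<close>

lemma prob_no_dipath_approx:
  assumes mn: "m \<le> n choose 2" and V: "{a, s, b, t} \<subseteq> {1..n}" and dist: "distinct [a, s, b, t]" and n: "7 \<le> n"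
  shows "\<bar>measure_pmf.prob (random_digraph n m) (no_dipath s a \<inter> no_dipath t b)
     - (\<Sum>i\<in>{0, 1, 2, 3}. measure_pmf.prob (random_digraph n m) (avoiding (extremal_forbidden n a s b t i)))\<bar>
     \<le> 4 * measure_pmf.prob (random_digraph n m) (middle_closed n \<union> mixed_closed n)"
proof -
  let ?P = "measure_pmf.prob (random_digraph n m)"
  let ?AB = "no_dipath s a \<inter> no_dipath t b"
  define X where "X i = avoiding (extremal_forbidden n a s b t i)" for i
  define I where "I = {0, 1, 2, 3 :: nat}"
  have finI: "finite I" "card I = 4" by (auto simp: I_def)
  define Z where "Z = middle_closed n \<union> mixed_closed n"
  have supp: "pverts G = {1..n}" "parcs G \<subseteq> complete_arcs n" if "G \<in> set_pmf (random_digraph n m)" for G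
    using random_digraph_support[OF mn that] .
  have "?P ?AB \<le> ?P ((\<Union>i\<in>I. X i) \<union> Z)"
  proof (rule measure_pmf.finite_measure_mono_AE)
    show "AE G in random_digraph n m. G \<in> ?AB \<longrightarrow> G \<in> (\<Union>i\<in>I. X i) \<union> Z"
      unfolding AE_measure_pmf_iff
    proof (intro ballI impI)
      fix G assume G: "G \<in> set_pmf (random_digraph n m)" "G \<in> ?AB"
      show "G \<in> (\<Union>i\<in>I. X i) \<union> Z"
        using no_dipath_imp_extremal[OF V dist supp[OF G(1)] G(2) _ _ n]
        unfolding X_def I_def Z_def by blast
    qed
  qed simp
  also have "\<dots> \<le> ?P (\<Union>i\<in>I. X i) + ?P Z"
    by (rule measure_Un_le) auto
  also have "?P (\<Union>i\<in>I. X i) \<le> (\<Sum>i\<in>I. ?P (X i))"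
    using finI by (intro measure_pmf.finite_measure_subadditive_finite) auto
  finally have upper: "?P ?AB \<le> (\<Sum>i\<in>I. ?P (X i)) + ?P Z" by simp
  have "(\<Sum>i\<in>I. ?P (X i)) - 4 * ?P Z = (\<Sum>i\<in>I. ?P (X i) - ?P Z)"
    by (simp add: sum_subtractf finI)
  also have "\<dots> \<le> (\<Sum>i\<in>I. ?P (X i - Z))"
  proof (rule sum_mono)
    fix i
    have "?P (X i) \<le> ?P ((X i - Z) \<union> Z)" by (rule measure_pmf.finite_measure_mono) auto
    also have "\<dots> \<le> ?P (X i - Z) + ?P Z" by (rule measure_Un_le) auto
    finally show "?P (X i) - ?P Z \<le> ?P (X i - Z)" by simp
  qed
  also have "\<dots> = ?P (\<Union>i\<in>I. X i - Z)"
  proof (rule measure_pmf.finite_measure_finite_Union[symmetric])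
    have "G \<in> Z" if "i \<in> I" "j \<in> I" "i < j" "G \<in> X i" "G \<in> X j" for i j G
      using extremal_disjoint[OF V dist that(4,5)[unfolded X_def] that(1,2)[unfolded I_def] that(3)]
      by (simp add: Z_def)
    then have "(X i - Z) \<inter> (X j - Z) = {}" if "i \<in> I" "j \<in> I" "i < j" for i j
      using that by blast
    then show "disjoint_family_on (\<lambda>i. X i - Z) I"
      unfolding disjoint_family_on_def by (metis Int_commute linorder_neq_iff)
  qed (use finI in auto)
  also have "\<dots> \<le> ?P ?AB"
  proof (rule measure_pmf.finite_measure_mono_AE)
    show "AE G in random_digraph n m. G \<in> (\<Union>i\<in>I. X i - Z) \<longrightarrow> G \<in> ?AB"
      unfolding AE_measure_pmf_iff
    proof (intro ballI impI)
      fix G assume G: "G \<in> set_pmf (random_digraph n m)" "G \<in> (\<Union>i\<in>I. X i - Z)"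
      then obtain i where "i \<in> {0, 1, 2, 3}" "G \<in> avoiding (extremal_forbidden n a s b t i)"
        unfolding X_def I_def by blast
      then show "G \<in> ?AB" by (rule extremal_imp_no_dipath[OF V dist supp[OF G(1)]])
    qed
  qed simp
  finally have lower: "(\<Sum>i\<in>I. ?P (X i)) - 4 * ?P Z \<le> ?P ?AB" .
  have "0 \<le> ?P Z" by simp
  with upper lower have "\<bar>?P ?AB - (\<Sum>i\<in>I. ?P (X i))\<bar> \<le> 4 * ?P Z" by linarith
  then show ?thesis by (simp only: X_def I_def Z_def)
qed

section \<open>Asymptotics of the extremal events and conclusion\<close>

lemma real_choose_two: "real (n choose 2) = real n * (real n - 1) / 2"
  by (induction n) (auto simp: numeral_2_eq_2 field_simps)

text \<open>For \<open>k = 2 n - d\<close> and \<open>N = n choose 2\<close> the quotient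
  \<open>k^2 / (2 N)\<close> tends to 4, the constant in the exponent. The condition
  \<open>k \<le> m\<close> of the exact formula holds eventually because \<open>m\<close> grows
  quadratically.\<close>

lemma prob_avoiding_linear_asymp:
  fixes p y :: real and m :: "nat \<Rightarrow> nat" and F :: "nat \<Rightarrow> (nat \<times> nat) set"
  assumes p: "0 < p" "p < 1" and y: "y = 1 - p / 2"
    and m: "\<And>n. m n = nat \<lfloor>p * real (n choose 2)\<rfloor>"
    and F: "\<forall>\<^sub>F n in sequentially. F n \<subseteq> complete_arcs n"
      "\<forall>\<^sub>F n in sequentially. \<forall>u v. (u, v) \<in> F n \<longrightarrow> (v, u) \<notin> F n"
      "\<forall>\<^sub>F n in sequentially. card (F n) = 2 * n - d"
  shows "(\<lambda>n. measure_pmf.prob (random_digraph n (m n)) (avoiding (F n)) / y ^ (2 * n - d))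
    \<longlonglongrightarrow> exp (- 4 * (p * (1 - p) / (2 - p)\<^sup>2))"
proof -
  have "(\<lambda>n. hypergeometric_half (n choose 2) (m n) (2 * n - d) / y ^ (2 * n - d))
    \<longlonglongrightarrow> exp (- (4 * (p * (1 - p) / (2 - p)\<^sup>2)))"
  proof (rule hypergeometric_half_asymp[OF p y m])
    show "filterlim (\<lambda>n. real (n choose 2)) at_top sequentially"
      unfolding real_choose_two by real_asymp
    show "filterlim (\<lambda>n. 2 * n - d) at_top sequentially"
      unfolding filterlim_at_top
    proof
      fix z show "\<forall>\<^sub>F n in sequentially. z \<le> 2 * n - d"
        using eventually_ge_at_top[of "z + d"] by eventually_elim simp
    qed
    have "(\<lambda>n. (2 * real n - real d)\<^sup>2 / (2 * (real n * (real n - 1) / 2))) \<longlonglongrightarrow> 4" by real_asymp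
    then show "(\<lambda>n. (real (2 * n - d))\<^sup>2 / (2 * real (n choose 2))) \<longlonglongrightarrow> 4"
    proof (rule Lim_transform_eventually)
      show "\<forall>\<^sub>F n in sequentially. (2 * real n - real d)\<^sup>2 / (2 * (real n * (real n - 1) / 2))
          = (real (2 * n - d))\<^sup>2 / (2 * real (n choose 2))"
        using eventually_ge_at_top[of d]
        by eventually_elim (simp add: of_nat_diff real_choose_two)
    qed
  qed
  moreover have "\<forall>\<^sub>F n in sequentially. 2 * real n + 1 \<le> p * (real n * (real n - 1) / 2)"
    using p by real_asymp
  then have "\<forall>\<^sub>F n in sequentially. hypergeometric_half (n choose 2) (m n) (2 * n - d) / y ^ (2 * n - d)
    = measure_pmf.prob (random_digraph n (m n)) (avoiding (F n)) / y ^ (2 * n - d)"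
    using F
  proof eventually_elim
    case (elim n)
    have "2 * n \<le> m n" unfolding m real_choose_two using elim(1) by linarith
    then have "measure_pmf.prob (random_digraph n (m n)) (avoiding (F n))
        = hypergeometric_half (n choose 2) (m n) (card (F n))"
      using elim by (intro prob_avoiding_single) (auto simp: m edge_count_le[OF p])
    then show ?case using elim by simp
  qed
  ultimately show ?thesis by (auto intro: Lim_transform_eventually)
qed

theorem theorem4p2:
  fixes p y :: real and m :: "nat \<Rightarrow> nat" and a s b t :: nat
  assumes p: "0 < p" "p < 1"
    and y: "y = 1 - p / 2"
    and m: "\<And>n. m n = nat \<lfloor>p * real (n choose 2)\<rfloor>"
    and vertices: "1 \<le> a" "1 \<le> s" "1 \<le> b" "1 \<le> t" "distinct [a, s, b, t]"
  shows "(\<lambda>n. measure_pmf.prob (random_digraph n (m n)) (no_dipath s a \<inter> no_dipath t b))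
    \<sim>[sequentially]
      (\<lambda>n. 2 * y ^ (2 * n - 4) * exp (- 4 * (p * (1 - p) / (2 - p)^2))
         + 2 * y ^ (2 * n - 3) * exp (- 4 * (p * (1 - p) / (2 - p)^2)))"
proof -
  define K where "K = exp (- 4 * (p * (1 - p) / (2 - p)^2))"
  have K0: "K > 0" by (simp add: K_def)
  have y01: "0 < y" "y < 1" using p y by auto
  define P where "P n = measure_pmf.prob (random_digraph n (m n))" for n
  define AB where "AB = no_dipath s a \<inter> no_dipath t b"
  define X where "X n i = avoiding (extremal_forbidden n a s b t i)" for n i
  define Z where "Z n = middle_closed n \<union> mixed_closed n" for n
  define D where "D n = y ^ (2 * n - 4)" for n
  have D0: "D n > 0" for n using y01 by (simp add: D_def)
  note dist = vertices(5)
  have V: "\<forall>\<^sub>F n in sequentially. {a, s, b, t} \<subseteq> {1..n}"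
    using eventually_ge_at_top[of "a + s + b + t"] by eventually_elim (use vertices in auto)
  have mn: "m n \<le> n choose 2" for n unfolding m by (rule edge_count_le[OF p])
  have X0: "(\<lambda>n. P n (X n i) / y ^ (2 * n - d)) \<longlonglongrightarrow> K"
    if "i \<in> {0, 1, 2, 3}" "d = (if i \<in> {0, 1} then 4 else 3)" for i d
    unfolding P_def X_def K_def
  proof (rule prob_avoiding_linear_asymp[OF p y m])
    show "\<forall>\<^sub>F n in sequentially. extremal_forbidden n a s b t i \<subseteq> complete_arcs n"
      using V by eventually_elim (rule extremal_forbidden_arcs(1)[OF _ dist that(1)])
    show "\<forall>\<^sub>F n in sequentially. \<forall>u v. (u, v) \<in> extremal_forbidden n a s b t i \<longrightarrow>
        (v, u) \<notin> extremal_forbidden n a s b t i"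
      using V extremal_forbidden_arcs(2)[OF _ dist that(1)] by (auto elim: eventually_mono)
    show "\<forall>\<^sub>F n in sequentially. card (extremal_forbidden n a s b t i) = 2 * n - d"
      using V
    proof eventually_elim
      case (elim n)
      then show ?case using that card_extremal_forbidden[OF elim dist] by auto
    qed
  qed
  \<comment> \<open>For \<open>n < 2\<close> both truncated exponents are 0, so this holds only
    eventually.\<close>
  have yD: "\<forall>\<^sub>F n in sequentially. y ^ (2 * n - 3) = y * D n"
    using eventually_ge_at_top[of 2]
  proof eventually_elim
    case (elim n)
    then have "2 * n - 3 = Suc (2 * n - 4)" by simp
    then show ?case by (simp add: D_def)
  qed
  have X1: "(\<lambda>n. P n (X n i) / D n) \<longlonglongrightarrow> K" if "i \<in> {0, 1}" for i
    using X0[of i 4] that unfolding D_def by auto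
  have X2: "(\<lambda>n. P n (X n i) / D n) \<longlonglongrightarrow> y * K" if "i \<in> {2, 3}" for i
  proof -
    have "(\<lambda>n. y * (P n (X n i) / y ^ (2 * n - 3))) \<longlonglongrightarrow> y * K"
      using X0[of i 3] that by (intro tendsto_mult_left) auto
    then show ?thesis
    proof (rule Lim_transform_eventually)
      show "\<forall>\<^sub>F n in sequentially. y * (P n (X n i) / y ^ (2 * n - 3)) = P n (X n i) / D n"
        using yD by eventually_elim (use y01 in simp)
    qed
  qed
  have X: "(\<lambda>n. (\<Sum>i\<in>{0, 1, 2, 3}. P n (X n i)) / D n) \<longlonglongrightarrow> K + (K + (y * K + y * K))"
  proof -
    have "(\<lambda>n. P n (X n 0) / D n + (P n (X n 1) / D n + (P n (X n 2) / D n + P n (X n 3) / D n)))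
      \<longlonglongrightarrow> K + (K + (y * K + y * K))"
      by (intro tendsto_add X1 X2) auto
    then show ?thesis by (simp add: add_divide_distrib)
  qed
  have lim6: "(\<lambda>n. real n ^ 6 * y ^ n) \<longlonglongrightarrow> 0" using y01 by real_asymp
  have Z: "(\<lambda>n. 4 * P n (Z n) / D n) \<longlonglongrightarrow> 0"
  proof (rule tendsto_sandwich)
    show "\<forall>\<^sub>F n in sequentially. 0 \<le> 4 * P n (Z n) / D n"
      using D0 by (intro always_eventually) (simp add: P_def less_imp_le)
    show "(\<lambda>_. 0 :: real) \<longlonglongrightarrow> 0" by simp
    \<comment> \<open>Each of the two negligible events has probability at most
      \<open>2 n^2 * n^4 * y ^ (3 n - 12)\<close>, and \<open>3 n - 12\<close> exceeds
      \<open>2 n - 4\<close> by \<open>n - 8\<close>. The constant is 2 events times 2 times the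
      factor 4.\<close>
    show "(\<lambda>n. 16 / y ^ 8 * (real n ^ 6 * y ^ n)) \<longlonglongrightarrow> 0" using tendsto_mult_left[OF lim6, of "16 / y ^ 8"] by simp
    have N1: "\<forall>\<^sub>F n in sequentially. 1 \<le> (real n * (real n - 1) / 2) * (1 - p)"
      using p by real_asymp
    have sm: "\<forall>\<^sub>F n in sequentially. real n ^ 6 * y ^ n < y ^ 7"
      using lim6 y01 by (intro order_tendstoD(2)) auto
    show "\<forall>\<^sub>F n in sequentially. 4 * P n (Z n) / D n \<le> 16 / y ^ 8 * (real n ^ 6 * y ^ n)"
      using N1 sm eventually_ge_at_top[of 8]
    proof eventually_elim
      case (elim n)
      have N: "1 \<le> real (n choose 2) * (1 - p)" using elim(1) by (simp add: real_choose_two)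
      \<comment> \<open>Squaring undoes the halved exponent; the integer division loses at most one,
        which leaves \<open>n - 7\<close> and explains the threshold \<open>y ^ 7\<close> in
        \<open>sm\<close>.\<close>
      have "(real n * y ^ ((n - 6) div 2))\<^sup>2 = real n ^ 2 * y ^ (2 * ((n - 6) div 2))"
        by (simp add: power_mult_distrib power_mult[symmetric] mult.commute)
      also have "\<dots> \<le> real n ^ 6 * y ^ (n - 7)"
        using elim(3) y01 by (intro mult_mono power_increasing power_decreasing) auto
      also have "y ^ (n - 7) = y ^ n / y ^ 7" using elim(3) y01 by (simp add: power_diff)
      also have "real n ^ 6 * (y ^ n / y ^ 7) \<le> 1\<^sup>2" using elim(2) y01 by simp
      finally have small: "real n * (1 - p / 2) ^ ((n - 6) div 2) \<le> 1"
        unfolding y[symmetric] by (rule power2_le_imp_le) simp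
      let ?c = "2 * (real (n choose 2) + 1)"
      have "2 * (real n * (real n - 1) / 2 + 1) \<le> 2 * real n ^ 2"
      proof -
        have "2 * 1 \<le> real n * (real n + 1)" using elim(3) by (intro mult_mono) auto
        then show ?thesis by (simp add: power2_eq_square field_simps)
      qed
      then have c: "?c \<le> 2 * real n ^ 2" by (simp add: real_choose_two)
      have "P n (Z n) \<le> P n (middle_closed n) + P n (mixed_closed n)"
        unfolding Z_def P_def by (rule measure_Un_le) auto
      also have "\<dots> \<le> ?c * real n ^ 4 * y ^ (3 * (n - 3)) + ?c * real n ^ 4 * y ^ (3 * n - 12)"
        unfolding P_def y
        by (intro add_mono prob_middle_closed_le[OF p m N small] prob_mixed_closed_le[OF p m N])
      also have "\<dots> \<le> ?c * real n ^ 4 * y ^ (3 * n - 12) + ?c * real n ^ 4 * y ^ (3 * n - 12)"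
        using y01 by (intro add_mono mult_left_mono power_decreasing) auto
      also have "\<dots> = 2 * ?c * (real n ^ 4 * y ^ (3 * n - 12))" by simp
      also have "\<dots> \<le> 2 * (2 * real n ^ 2) * (real n ^ 4 * y ^ (3 * n - 12))"
        using c y01 by (intro mult_right_mono) auto
      also have "\<dots> = 4 * real n ^ 6 * y ^ (3 * n - 12)" by (simp flip: power_add mult.assoc)
      also have "3 * n - 12 = (n - 8) + (2 * n - 4)" using elim(3) by simp
      also have "y ^ (n - 8 + (2 * n - 4)) = y ^ (n - 8) * D n" by (simp only: power_add D_def)
      also have "y ^ (n - 8) = y ^ n / y ^ 8" using elim(3) y01 by (simp add: power_diff)
      also have "4 * real n ^ 6 * (y ^ n / y ^ 8 * D n) = 4 * real n ^ 6 * (y ^ n / y ^ 8) * D n" by simp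
      finally have "P n (Z n) \<le> 4 * real n ^ 6 * (y ^ n / y ^ 8) * D n" .
      then have "P n (Z n) / D n \<le> 4 * real n ^ 6 * (y ^ n / y ^ 8)"
        using D0[of n] by (simp add: pos_divide_le_eq)
      from mult_left_mono[OF this, of 4] show ?case by (simp add: mult_ac)
    qed
  qed
  have "(\<lambda>n. P n AB / D n - (\<Sum>i\<in>{0, 1, 2, 3}. P n (X n i)) / D n) \<longlonglongrightarrow> 0"
  proof (rule Lim_null_comparison[OF _ Z])
    show "\<forall>\<^sub>F n in sequentially. norm (P n AB / D n - (\<Sum>i\<in>{0, 1, 2, 3}. P n (X n i)) / D n) \<le> 4 * P n (Z n) / D n"
      using V eventually_ge_at_top[of 7]
    proof eventually_elim
      case (elim n)
      have "\<bar>P n AB - (\<Sum>i\<in>{0, 1, 2, 3}. P n (X n i))\<bar> \<le> 4 * P n (Z n)"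
        unfolding P_def AB_def X_def Z_def
        by (rule prob_no_dipath_approx[OF mn elim(1) dist elim(2)])
      then show ?case using D0[of n] by (simp add: diff_divide_distrib[symmetric] divide_right_mono)
    qed
  qed
  from tendsto_add[OF this X] have lim: "(\<lambda>n. P n AB / D n) \<longlonglongrightarrow> 2 * K + 2 * y * K"
    by (simp add: mult_ac)
  have pos: "2 * K + 2 * y * K > 0" using K0 y01 by (simp add: add_pos_pos)
  have "(\<lambda>n. P n AB / D n / (2 * K + 2 * y * K)) \<longlonglongrightarrow> (2 * K + 2 * y * K) / (2 * K + 2 * y * K)"
    using pos by (intro tendsto_divide lim tendsto_const) auto
  then have lim1: "(\<lambda>n. P n AB / D n / (2 * K + 2 * y * K)) \<longlonglongrightarrow> 1" using pos by simp
  have "(\<lambda>n. P n AB / (2 * y ^ (2 * n - 4) * K + 2 * y ^ (2 * n - 3) * K)) \<longlonglongrightarrow> 1"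
    using lim1
  proof (rule Lim_transform_eventually)
    show "\<forall>\<^sub>F n in sequentially. P n AB / D n / (2 * K + 2 * y * K)
        = P n AB / (2 * y ^ (2 * n - 4) * K + 2 * y ^ (2 * n - 3) * K)"
      using yD
    proof eventually_elim
      case (elim n)
      have "2 * y ^ (2 * n - 4) * K + 2 * y ^ (2 * n - 3) * K = D n * (2 * K + 2 * y * K)"
        unfolding elim D_def[symmetric] by (simp add: algebra_simps)
      then show ?case by simp
    qed
  qed
  then show ?thesis unfolding P_def AB_def K_def by (rule asymp_equivI')
qed

end
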